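(* Let $B(z,u,c)$ be a quantifier-free formula and suppose $\mathsf{EA}\vdash\exists z\forall u\, B(z,u,c)$. Then there exist elementary recursive functions $f(c,w)$, $h(c,w)$ and a natural number $K$ such that (1) (weakly descending) $\mathsf{EA}\vdash K>h(c,w)\geq h(c,w+1)$; (2) (lowering) $\mathsf{EA}\vdash f(c,w)\neq f(c,w+1)\to h(c,w)>h(c,w+1)$; (3) $\mathsf{EA}\vdash\lim_{w\to\infty}f(c,w)=z\to\forall u\, B(z,u,c)$.
   Context: $\mathsf{EA}$ (elementary recursive arithmetic) is the first-order theory whose language has a function symbol for each code of an elementary recursive function, with purely universal defining axioms and induction restricted to quantifier-free formulas. The formula $\lim_{w\to\infty}f(c,w)=z$ abbreviates $\exists m\forall w\geq m\, f(c,w)=z$. Provability of a formula with free variables means provability with those variables free. *)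

theory Defs
  imports Main
begin

text \<open>
  Codes of (Kalmar) elementary recursive functions: the least class containing the initial
  functions below and closed under composition and under the bounded sums and products
  \<open>\<Sum>i<k. g(i, x\<^sub>1, \<dots>, x\<^sub>n)\<close> and \<open>\<Prod>i<k. g(i, x\<^sub>1, \<dots>, x\<^sub>n)\<close>, taken as functions of
  \<open>(k, x\<^sub>1, \<dots>, x\<^sub>n)\<close>.  The arity \<open>n\<close> in \<open>CComp n f gs\<close> is explicit because \<open>gs\<close> may be empty.
\<close>

datatype efun =
    CZero
  | CSucc
  | CPred
  | CProj nat nat
  | CAdd
  | CMul
  | CMonus
  | CComp nat efun "efun list"
  | CSum efun
  | CProd efun

inductive elem_code :: "nat \<Rightarrow> efun \<Rightarrow> bool" where
  zero: "elem_code 0 CZero"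
| succ: "elem_code 1 CSucc"
| pred: "elem_code 1 CPred"
| proj: "i < n \<Longrightarrow> elem_code n (CProj n i)"
| add: "elem_code 2 CAdd"
| mul: "elem_code 2 CMul"
| monus: "elem_code 2 CMonus"
| comp: "elem_code (length gs) f \<Longrightarrow> (\<And>g. g \<in> set gs \<Longrightarrow> elem_code n g) \<Longrightarrow>
    elem_code n (CComp n f gs)"
| sum: "elem_code (Suc n) g \<Longrightarrow> elem_code (Suc n) (CSum g)"
| prod: "elem_code (Suc n) g \<Longrightarrow> elem_code (Suc n) (CProd g)"

text \<open>
  First-order syntax with de Bruijn indices; equality is the only relation symbol.
\<close>

datatype tm = Var nat | Fn efun "tm list"

datatype fm =
    Bot
  | Eq tm tm  (infix \<open>\<^bold>=\<close> 60)
  | Imp fm fm  (infixr \<open>\<^bold>\<longrightarrow>\<close> 55)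
  | Forall fm

fun wf_tm :: "tm \<Rightarrow> bool" where
  "wf_tm (Var i) \<longleftrightarrow> True"
| "wf_tm (Fn f ts) \<longleftrightarrow> elem_code (length ts) f \<and> (\<forall>t \<in> set ts. wf_tm t)"

primrec wf_fm :: "fm \<Rightarrow> bool" where
  "wf_fm Bot \<longleftrightarrow> True"
| "wf_fm (s \<^bold>= t) \<longleftrightarrow> wf_tm s \<and> wf_tm t"
| "wf_fm (p \<^bold>\<longrightarrow> q) \<longleftrightarrow> wf_fm p \<and> wf_fm q"
| "wf_fm (Forall p) \<longleftrightarrow> wf_fm p"

primrec quantifier_free :: "fm \<Rightarrow> bool" where
  "quantifier_free Bot \<longleftrightarrow> True"
| "quantifier_free (s \<^bold>= t) \<longleftrightarrow> True"
| "quantifier_free (p \<^bold>\<longrightarrow> q) \<longleftrightarrow> quantifier_free p \<and> quantifier_free q"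
| "quantifier_free (Forall p) \<longleftrightarrow> False"

fun vars_tm :: "tm \<Rightarrow> nat set" where
  "vars_tm (Var i) = {i}"
| "vars_tm (Fn f ts) = (\<Union>t \<in> set ts. vars_tm t)"

primrec free_vars :: "fm \<Rightarrow> nat set" where
  "free_vars Bot = {}"
| "free_vars (s \<^bold>= t) = vars_tm s \<union> vars_tm t"
| "free_vars (p \<^bold>\<longrightarrow> q) = free_vars p \<union> free_vars q"
| "free_vars (Forall p) = {i. Suc i \<in> free_vars p}"

abbreviation Neg :: "fm \<Rightarrow> fm" where
  "Neg p \<equiv> p \<^bold>\<longrightarrow> Bot"

abbreviation Conj :: "fm \<Rightarrow> fm \<Rightarrow> fm"  (infixr \<open>\<^bold>\<and>\<close> 57) where
  "p \<^bold>\<and> q \<equiv> Neg (p \<^bold>\<longrightarrow> Neg q)"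

abbreviation Exists :: "fm \<Rightarrow> fm" where
  "Exists p \<equiv> Neg (Forall (Neg p))"

text \<open>Simultaneous capture-avoiding substitution.\<close>

primrec subst_tm :: "(nat \<Rightarrow> tm) \<Rightarrow> tm \<Rightarrow> tm" where
  "subst_tm \<sigma> (Var i) = \<sigma> i"
| "subst_tm \<sigma> (Fn f ts) = Fn f (map (subst_tm \<sigma>) ts)"

abbreviation lift_tm :: "tm \<Rightarrow> tm" where
  "lift_tm \<equiv> subst_tm (\<lambda>i. Var (Suc i))"

primrec subst_fm :: "(nat \<Rightarrow> tm) \<Rightarrow> fm \<Rightarrow> fm" where
  "subst_fm \<sigma> Bot = Bot"
| "subst_fm \<sigma> (s \<^bold>= t) = (subst_tm \<sigma> s \<^bold>= subst_tm \<sigma> t)"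
| "subst_fm \<sigma> (p \<^bold>\<longrightarrow> q) = (subst_fm \<sigma> p \<^bold>\<longrightarrow> subst_fm \<sigma> q)"
| "subst_fm \<sigma> (Forall p) = Forall (subst_fm (case_nat (Var 0) (\<lambda>i. lift_tm (\<sigma> i))) p)"

abbreviation lift_fm :: "fm \<Rightarrow> fm" where
  "lift_fm \<equiv> subst_fm (\<lambda>i. Var (Suc i))"

text \<open>The instance \<open>p(t)\<close> of the body \<open>p\<close> of a quantifier.\<close>

abbreviation inst :: "fm \<Rightarrow> tm \<Rightarrow> fm" where
  "inst p t \<equiv> subst_fm (case_nat t Var) p"

text \<open>
  Classical natural deduction with equality from a set \<open>T\<close> of axioms.  The axioms may contain
  free variables, which are read universally: \<open>axm\<close> is available in every context, so \<open>all_I\<close>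
  may generalize over them.
\<close>

inductive deriv :: "fm set \<Rightarrow> fm list \<Rightarrow> fm \<Rightarrow> bool" for T :: "fm set" where
  axm: "p \<in> T \<Longrightarrow> deriv T \<Gamma> p"
| assm: "p \<in> set \<Gamma> \<Longrightarrow> wf_fm p \<Longrightarrow> deriv T \<Gamma> p"
| imp_I: "wf_fm p \<Longrightarrow> deriv T (p # \<Gamma>) q \<Longrightarrow> deriv T \<Gamma> (p \<^bold>\<longrightarrow> q)"
| imp_E: "deriv T \<Gamma> (p \<^bold>\<longrightarrow> q) \<Longrightarrow> deriv T \<Gamma> p \<Longrightarrow> deriv T \<Gamma> q"
| contra: "wf_fm p \<Longrightarrow> deriv T (Neg p # \<Gamma>) Bot \<Longrightarrow> deriv T \<Gamma> p"
| all_I: "deriv T (map lift_fm \<Gamma>) p \<Longrightarrow> deriv T \<Gamma> (Forall p)"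
| all_E: "deriv T \<Gamma> (Forall p) \<Longrightarrow> wf_tm t \<Longrightarrow> deriv T \<Gamma> (inst p t)"
| eq_refl: "wf_tm t \<Longrightarrow> deriv T \<Gamma> (t \<^bold>= t)"
| eq_subst: "deriv T \<Gamma> (s \<^bold>= t) \<Longrightarrow> deriv T \<Gamma> (inst p s) \<Longrightarrow> deriv T \<Gamma> (inst p t)"

definition provable :: "fm set \<Rightarrow> fm \<Rightarrow> bool"  (infix \<open>\<turnstile>\<close> 50) where
  "T \<turnstile> p \<longleftrightarrow> deriv T [] p"

abbreviation Zero :: tm where "Zero \<equiv> Fn CZero []"
abbreviation Succ :: "tm \<Rightarrow> tm" where "Succ t \<equiv> Fn CSucc [t]"
abbreviation Pred :: "tm \<Rightarrow> tm" where "Pred t \<equiv> Fn CPred [t]"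
abbreviation Add :: "tm \<Rightarrow> tm \<Rightarrow> tm" where "Add s t \<equiv> Fn CAdd [s, t]"
abbreviation Mul :: "tm \<Rightarrow> tm \<Rightarrow> tm" where "Mul s t \<equiv> Fn CMul [s, t]"
abbreviation Monus :: "tm \<Rightarrow> tm \<Rightarrow> tm" where "Monus s t \<equiv> Fn CMonus [s, t]"

primrec numeral_tm :: "nat \<Rightarrow> tm" where
  "numeral_tm 0 = Zero"
| "numeral_tm (Suc n) = Succ (numeral_tm n)"

text \<open>The order is expressed by quantifier-free formulas using truncated subtraction.\<close>

abbreviation Le :: "tm \<Rightarrow> tm \<Rightarrow> fm"  (infix \<open>\<^bold>\<le>\<close> 60) where
  "s \<^bold>\<le> t \<equiv> Monus s t \<^bold>= Zero"

abbreviation Less :: "tm \<Rightarrow> tm \<Rightarrow> fm"  (infix \<open>\<^bold><\<close> 60) where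
  "s \<^bold>< t \<equiv> Succ s \<^bold>\<le> t"

text \<open>
  In \<open>induction\<close>, \<open>Var 0\<close> is the induction variable and all other variables of \<open>p\<close> are
  parameters; the substitution there replaces \<open>Var 0\<close> by its successor.
\<close>

inductive_set EA :: "fm set" where
  succ_nonzero: "Neg (Succ (Var 0) \<^bold>= Zero) \<in> EA"
| succ_inj: "(Succ (Var 0) \<^bold>= Succ (Var 1) \<^bold>\<longrightarrow> Var 0 \<^bold>= Var 1) \<in> EA"
| pred_zero: "(Pred Zero \<^bold>= Zero) \<in> EA"
| pred_succ: "(Pred (Succ (Var 0)) \<^bold>= Var 0) \<in> EA"
| proj: "i < n \<Longrightarrow> (Fn (CProj n i) (map Var [0..<n]) \<^bold>= Var i) \<in> EA"
| add_zero: "(Add (Var 0) Zero \<^bold>= Var 0) \<in> EA"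
| add_succ: "(Add (Var 0) (Succ (Var 1)) \<^bold>= Succ (Add (Var 0) (Var 1))) \<in> EA"
| mul_zero: "(Mul (Var 0) Zero \<^bold>= Zero) \<in> EA"
| mul_succ: "(Mul (Var 0) (Succ (Var 1)) \<^bold>= Add (Mul (Var 0) (Var 1)) (Var 0)) \<in> EA"
| monus_zero: "(Monus (Var 0) Zero \<^bold>= Var 0) \<in> EA"
| monus_succ: "(Monus (Var 0) (Succ (Var 1)) \<^bold>= Pred (Monus (Var 0) (Var 1))) \<in> EA"
| comp: "elem_code n (CComp n f gs) \<Longrightarrow>
    (Fn (CComp n f gs) (map Var [0..<n]) \<^bold>= Fn f (map (\<lambda>g. Fn g (map Var [0..<n])) gs)) \<in> EA"
| sum_zero: "elem_code (Suc n) g \<Longrightarrow>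
    (Fn (CSum g) (Zero # map Var [1..<Suc n]) \<^bold>= Zero) \<in> EA"
| sum_succ: "elem_code (Suc n) g \<Longrightarrow>
    (Fn (CSum g) (Succ (Var 0) # map Var [1..<Suc n]) \<^bold>=
      Add (Fn (CSum g) (map Var [0..<Suc n])) (Fn g (map Var [0..<Suc n]))) \<in> EA"
| prod_zero: "elem_code (Suc n) g \<Longrightarrow>
    (Fn (CProd g) (Zero # map Var [1..<Suc n]) \<^bold>= Succ Zero) \<in> EA"
| prod_succ: "elem_code (Suc n) g \<Longrightarrow>
    (Fn (CProd g) (Succ (Var 0) # map Var [1..<Suc n]) \<^bold>=
      Mul (Fn (CProd g) (map Var [0..<Suc n])) (Fn g (map Var [0..<Suc n]))) \<in> EA"
| induction: "wf_fm p \<Longrightarrow> quantifier_free p \<Longrightarrow>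
    (inst p Zero \<^bold>\<longrightarrow>
      Forall (p \<^bold>\<longrightarrow> subst_fm (case_nat (Succ (Var 0)) (\<lambda>i. Var (Suc i))) p) \<^bold>\<longrightarrow>
      Forall p) \<in> EA"

text \<open>
  \<open>lim\<^bsub>w\<rightarrow>\<infinity>\<^esub> f(c, w) = z\<close>, that is, \<open>\<exists>m. \<forall>w\<ge>m. f(c, w) = z\<close>.  Below the two quantifiers
  \<open>w\<close> is \<open>Var 0\<close> and \<open>m\<close> is \<open>Var 1\<close>.
\<close>

definition Lim_eq :: "efun \<Rightarrow> tm \<Rightarrow> tm \<Rightarrow> fm" where
  "Lim_eq f c z = Exists (Forall (Var 1 \<^bold>\<le> Var 0 \<^bold>\<longrightarrow>
     Fn f [lift_tm (lift_tm c), Var 0] \<^bold>= lift_tm (lift_tm z)))"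

end

theory Submission
  imports Defs "HOL-Library.Countable_Set" "HOL-Library.Nat_Bijection"
begin

text \<open>
  \<open>EA\<close> is essentially universal: a counterexample to an instance of quantifier-free induction is
  found by an elementary bounded search.  Hence the quantifier-free consequences of \<open>EA\<close> are
  already decided by term models, and a term model in which every term \<open>t\<close> is refuted as a value of
  \<open>z\<close> by a variable of its own would contradict \<open>\<exists>z. \<forall>u. B\<close>.  This yields Herbrand terms
  \<open>t\<^sub>1(c), t\<^sub>2(c, u\<^sub>1), \<dots>, t\<^sub>n(c, u\<^sub>1, \<dots>, u\<^sub>n\<^sub>-\<^sub>1)\<close> such that \<open>EA\<close> proves the disjunction of the
  \<open>B(t\<^sub>i, u\<^sub>i, c)\<close>.  Given \<open>w\<close>, search below \<open>w\<close> for the least \<open>u\<^sub>1\<close> refuting \<open>t\<^sub>1\<close>, then for the least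
  \<open>u\<^sub>2\<close> refuting \<open>t\<^sub>2(c, u\<^sub>1)\<close>, and so on; by the disjunction some \<open>t\<^sub>i\<close> is not refuted.  For the
  first such \<open>i\<close> put \<open>f(c, w) = t\<^sub>i\<close> and \<open>h(c, w) = n - i + 1\<close>.  As \<open>w\<close> grows, refuted terms stay
  refuted by the same witnesses, so \<open>f\<close> changes only when \<open>h\<close> drops.
\<close>

section \<open>Substitution and derivations\<close>

lemma subst_tm_cong: "(\<And>i. i \<in> vars_tm t \<Longrightarrow> \<sigma> i = \<tau> i) \<Longrightarrow> subst_tm \<sigma> t = subst_tm \<tau> t"
  by (induction t) auto

lemma subst_tm_Var [simp]: "subst_tm Var t = t"
  by (induction t) (auto simp: map_idI)

lemma subst_tm_subst_tm: "subst_tm \<sigma> (subst_tm \<tau> t) = subst_tm (\<lambda>i. subst_tm \<sigma> (\<tau> i)) t"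
  by (induction t) auto

lemma wf_subst_tm: "wf_tm t \<Longrightarrow> (\<And>i. wf_tm (\<sigma> i)) \<Longrightarrow> wf_tm (subst_tm \<sigma> t)"
  by (induction t) auto

lemma wf_subst_fm: "wf_fm p \<Longrightarrow> (\<And>i. wf_tm (\<sigma> i)) \<Longrightarrow> wf_fm (subst_fm \<sigma> p)"
proof (induction p arbitrary: \<sigma>)
  case (Forall p)
  have "wf_tm (case_nat (Var 0) (\<lambda>i. lift_tm (\<sigma> i)) i)" for i
    using Forall.prems by (auto intro: wf_subst_tm split: nat.split)
  then show ?case using Forall by simp
qed (auto intro: wf_subst_tm)

lemma quantifier_free_subst [simp]: "quantifier_free (subst_fm \<sigma> p) = quantifier_free p"
  by (induction p arbitrary: \<sigma>) auto

lemma finite_vars_tm [simp]: "finite (vars_tm t)"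
  by (induction t) auto

lemma finite_free_vars [simp]: "finite (free_vars p)"
proof (induction p)
  case (Forall p)
  have "{i. Suc i \<in> free_vars p} = Suc -` free_vars p" by auto
  then show ?case using Forall by (simp add: finite_vimageI)
qed auto

lemma subst_fm_cong: "(\<And>i. i \<in> free_vars p \<Longrightarrow> \<sigma> i = \<tau> i) \<Longrightarrow> subst_fm \<sigma> p = subst_fm \<tau> p"
proof (induction p arbitrary: \<sigma> \<tau>)
  case (Eq s t)
  then show ?case by (auto intro: subst_tm_cong)
next
  case (Imp p q)
  have "subst_fm \<sigma> p = subst_fm \<tau> p" "subst_fm \<sigma> q = subst_fm \<tau> q"
    by (rule Imp.IH, use Imp.prems in simp)+
  then show ?case by simp
next
  case (Forall p)
  have "subst_fm (case_nat (Var 0) (\<lambda>i. lift_tm (\<sigma> i))) p =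
      subst_fm (case_nat (Var 0) (\<lambda>i. lift_tm (\<tau> i))) p"
    by (rule Forall.IH) (use Forall.prems in \<open>auto split: nat.split\<close>)
  then show ?case by simp
qed auto

lemma subst_fm_Var [simp]: "subst_fm Var p = p"
proof (induction p)
  case (Forall p)
  have "case_nat (Var 0) (\<lambda>i. Var (Suc i)) = Var" by (auto split: nat.splits)
  with Forall show ?case by simp
qed auto

lemma subst_fm_subst_fm: "subst_fm \<sigma> (subst_fm \<tau> p) = subst_fm (\<lambda>i. subst_tm \<sigma> (\<tau> i)) p"
proof (induction p arbitrary: \<sigma> \<tau>)
  case (Forall p)
  show ?case
    by (simp add: Forall.IH) (rule subst_fm_cong, simp add: subst_tm_subst_tm split: nat.splits)
qed (auto simp: subst_tm_subst_tm)

section \<open>Structural rules, substitution and equality reasoning in the calculus\<close>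

lemma deriv_weaken: "deriv T \<Gamma> p \<Longrightarrow> set \<Gamma> \<subseteq> set \<Delta> \<Longrightarrow> deriv T \<Delta> p"
proof (induction arbitrary: \<Delta> rule: deriv.induct)
  case (imp_I p \<Gamma> q)
  have "deriv T (p # \<Delta>) q" by (rule imp_I.IH) (use imp_I.prems in auto)
  with imp_I.hyps show ?case by (blast intro: deriv.imp_I)
next
  case (imp_E \<Gamma> p q)
  then show ?case by (blast intro: deriv.imp_E)
next
  case (contra p \<Gamma>)
  have "deriv T (Neg p # \<Delta>) Bot" by (rule contra.IH) (use contra.prems in auto)
  with contra.hyps show ?case by (blast intro: deriv.contra)
next
  case (all_I \<Gamma> p)
  have "deriv T (map lift_fm \<Delta>) p" by (rule all_I.IH) (use all_I.prems in auto)
  then show ?case by (rule deriv.all_I)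
next
  case (all_E \<Gamma> p t)
  then show ?case by (blast intro: deriv.all_E)
next
  case (eq_subst \<Gamma> s t p)
  then show ?case by (blast intro: deriv.eq_subst)
qed (auto intro: deriv.axm deriv.assm deriv.eq_refl)

lemma deriv_Bot_E: "deriv T \<Gamma> Bot \<Longrightarrow> wf_fm p \<Longrightarrow> deriv T \<Gamma> p"
  by (rule contra) (auto intro: deriv_weaken)

text \<open>\<open>all_E\<close> instantiates one variable at a time; stripping the quantifiers one
  after another amounts to a simultaneous substitution. Variables free under the prefix come down by
  \<open>n\<close>.\<close>

lemma deriv_closure:
  "T \<turnstile> (Forall ^^ n) p \<Longrightarrow> (\<And>i. wf_tm (\<sigma> i)) \<Longrightarrow>
    T \<turnstile> subst_fm (\<lambda>i. if i < n then \<sigma> i else Var (i - n)) p"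
proof (induction n arbitrary: p \<sigma>)
  case 0
  then show ?case by simp
next
  case (Suc n)
  have "T \<turnstile> (Forall ^^ n) (Forall p)" using Suc.prems(1) by (simp add: funpow_swap1)
  from Suc.IH[OF this, of "\<lambda>i. \<sigma> (Suc i)"] Suc.prems(2)
  have "T \<turnstile> subst_fm (\<lambda>i. if i < n then \<sigma> (Suc i) else Var (i - n)) (Forall p)" by simp
  then have "deriv T [] (inst (subst_fm (case_nat (Var 0)
      (\<lambda>i. lift_tm (if i < n then \<sigma> (Suc i) else Var (i - n)))) p) (\<sigma> 0))"
    unfolding provable_def using all_E Suc.prems(2) by simp
  also have "inst (subst_fm (case_nat (Var 0)
      (\<lambda>i. lift_tm (if i < n then \<sigma> (Suc i) else Var (i - n)))) p) (\<sigma> 0)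
    = subst_fm (\<lambda>i. if i < Suc n then \<sigma> i else Var (i - Suc n)) p"
    unfolding subst_fm_subst_fm
    by (rule subst_fm_cong) (auto simp: subst_tm_subst_tm split: nat.splits)
  finally show ?case unfolding provable_def .
qed

lemma provable_generalize: "T \<turnstile> p \<Longrightarrow> T \<turnstile> (Forall ^^ n) p"
  by (induction n) (auto simp: provable_def intro: all_I)

text \<open>In the empty context \<open>all_I\<close> can close off all variables, and the closure
  is then instantiated by \<open>\<sigma>\<close>. The length of the prefix exceeds every free
  index, so the shifted default is never reached.\<close>

lemma provable_subst:
  assumes "T \<turnstile> (Forall ^^ m) p" "\<And>i. wf_tm (\<sigma> i)"
  shows "T \<turnstile> subst_fm \<sigma> p"
proof -
  obtain n where n: "\<And>i. i \<in> free_vars p \<Longrightarrow> i < n"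
    using finite_nat_set_iff_bounded[of "free_vars p"] by auto
  have "T \<turnstile> (Forall ^^ (n + m)) p"
    using provable_generalize[OF assms(1), of n] by (simp add: funpow_add)
  from deriv_closure[OF this assms(2)]
  have "T \<turnstile> subst_fm (\<lambda>i. if i < n + m then \<sigma> i else Var (i - (n + m))) p" .
  also have "subst_fm (\<lambda>i. if i < n + m then \<sigma> i else Var (i - (n + m))) p = subst_fm \<sigma> p"
    by (rule subst_fm_cong) (auto dest: n)
  finally show ?thesis .
qed

text \<open>Leibniz's rule for a template in which \<open>Var 0\<close> marks the place to be
  replaced; lifting keeps this hole out of the other terms. Transitivity and congruence use the same
  device.\<close>

lemma deriv_sym: "deriv T \<Gamma> (s \<^bold>= t) \<Longrightarrow> wf_tm s \<Longrightarrow> deriv T \<Gamma> (t \<^bold>= s)"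
  using eq_subst[of T \<Gamma> s t "Var 0 \<^bold>= lift_tm s"]
  by (simp add: subst_tm_subst_tm eq_refl)

lemma deriv_trans: "deriv T \<Gamma> (s \<^bold>= t) \<Longrightarrow> deriv T \<Gamma> (t \<^bold>= r) \<Longrightarrow> deriv T \<Gamma> (s \<^bold>= r)"
  using eq_subst[of T \<Gamma> t r "lift_tm s \<^bold>= Var 0"]
  by (simp add: subst_tm_subst_tm)

lemma deriv_cong1:
  assumes "deriv T \<Gamma> (s \<^bold>= t)" "wf_tm (Fn f (xs @ s # ys))"
  shows "deriv T \<Gamma> (Fn f (xs @ s # ys) \<^bold>= Fn f (xs @ t # ys))"
  using eq_subst[OF assms(1), of "lift_tm (Fn f (xs @ s # ys)) \<^bold>=
      Fn f (map lift_tm xs @ Var 0 # map lift_tm ys)"] eq_refl[OF assms(2)]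
  by (simp add: subst_tm_subst_tm comp_def)

text \<open>Arguments are replaced from left to right; the prefix \<open>xs\<close> collects those
  already replaced.\<close>

lemma deriv_cong:
  assumes "list_all2 (\<lambda>s t. deriv T \<Gamma> (s \<^bold>= t)) ss ts" "wf_tm (Fn f (xs @ ss))" "\<forall>t \<in> set ts. wf_tm t"
  shows "deriv T \<Gamma> (Fn f (xs @ ss) \<^bold>= Fn f (xs @ ts))"
  using assms
proof (induction arbitrary: xs rule: list_all2_induct)
  case Nil
  then show ?case by (simp add: eq_refl)
next
  case (Cons s ss t ts)
  have "deriv T \<Gamma> (Fn f (xs @ s # ss) \<^bold>= Fn f (xs @ t # ss))"
    using deriv_cong1 Cons by blast
  moreover have "deriv T \<Gamma> (Fn f ((xs @ [t]) @ ss) \<^bold>= Fn f ((xs @ [t]) @ ts))"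
    using Cons.IH[of "xs @ [t]"] Cons.prems by auto
  ultimately show ?case using deriv_trans by simp
qed

section \<open>Semantics\<close>

primrec eval :: "(efun \<Rightarrow> 'a list \<Rightarrow> 'a) \<Rightarrow> (nat \<Rightarrow> 'a) \<Rightarrow> tm \<Rightarrow> 'a" where
  "eval F v (Var i) = v i"
| "eval F v (Fn f ts) = F f (map (eval F v) ts)"

primrec sat :: "(efun \<Rightarrow> 'a list \<Rightarrow> 'a) \<Rightarrow> (nat \<Rightarrow> 'a) \<Rightarrow> fm \<Rightarrow> bool" where
  "sat F v Bot \<longleftrightarrow> False"
| "sat F v (s \<^bold>= t) \<longleftrightarrow> eval F v s = eval F v t"
| "sat F v (p \<^bold>\<longrightarrow> q) \<longleftrightarrow> (sat F v p \<longrightarrow> sat F v q)"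
| "sat F v (Forall p) \<longleftrightarrow> (\<forall>a. sat F (case_nat a v) p)"

lemma eval_cong: "(\<And>i. i \<in> vars_tm t \<Longrightarrow> v i = w i) \<Longrightarrow> eval F v t = eval F w t"
proof (induction t)
  case (Fn f ts)
  then have "map (eval F v) ts = map (eval F w) ts" by auto
  then show ?case by (simp del: map_eq_conv)
qed auto

lemma sat_cong: "(\<And>i. i \<in> free_vars p \<Longrightarrow> v i = w i) \<Longrightarrow> sat F v p = sat F w p"
proof (induction p arbitrary: v w)
  case (Eq s t)
  then have "eval F v s = eval F w s" "eval F v t = eval F w t" by (auto intro!: eval_cong)
  then show ?case by simp
next
  case (Imp p q)
  have "sat F v p = sat F w p" "sat F v q = sat F w q"
    by (rule Imp.IH, use Imp.prems in simp)+
  then show ?case by simp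
next
  case (Forall p)
  have "sat F (case_nat a v) p = sat F (case_nat a w) p" for a
    by (rule Forall.IH) (use Forall.prems in \<open>auto split: nat.split\<close>)
  then show ?case by simp
qed auto

lemma eval_subst: "eval F v (subst_tm \<sigma> t) = eval F (\<lambda>i. eval F v (\<sigma> i)) t"
proof (induction t)
  case (Fn f ts)
  then have "map (eval F v \<circ> subst_tm \<sigma>) ts = map (eval F (\<lambda>i. eval F v (\<sigma> i))) ts" by auto
  then show ?case by (simp del: map_eq_conv)
qed auto

lemma sat_subst: "sat F v (subst_fm \<sigma> p) = sat F (\<lambda>i. eval F v (\<sigma> i)) p"
proof (induction p arbitrary: v \<sigma>)
  case (Forall p)
  have "(\<lambda>i. eval F (case_nat a v) (case_nat (Var 0) (\<lambda>i. lift_tm (\<sigma> i)) i)) =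
      case_nat a (\<lambda>i. eval F v (\<sigma> i))" for a
    by (auto simp: eval_subst split: nat.splits)
  then show ?case by (simp add: Forall.IH)
qed (auto simp: eval_subst)

lemma eval_case_nat: "(\<lambda>i. eval F v (case_nat t \<sigma> i)) = case_nat (eval F v t) (\<lambda>i. eval F v (\<sigma> i))"
  by (auto split: nat.splits)

text \<open>\<open>all_I\<close> passes to other valuations, so the axioms are assumed under all of
  them, the context only under \<open>v\<close>.\<close>

lemma soundness:
  assumes "deriv T \<Gamma> p" "\<And>q v. q \<in> T \<Longrightarrow> sat F v q" "\<forall>q \<in> set \<Gamma>. sat F v q"
  shows "sat F v p"
  using assms(1,3)
proof (induction arbitrary: v rule: deriv.induct)
  case (axm p \<Gamma>)
  then show ?case using assms(2) by blast
next
  case (contra p \<Gamma>)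
  then show ?case by fastforce
next
  case (all_I \<Gamma> p)
  then show ?case by (auto simp: sat_subst)
next
  case (all_E \<Gamma> p t)
  then show ?case by (auto simp: sat_subst eval_case_nat)
next
  case (eq_subst \<Gamma> s t p)
  then show ?case by (auto simp: sat_subst eval_case_nat)
qed auto

section \<open>Completeness for quantifier-free formulas\<close>

definition consistent :: "fm set \<Rightarrow> fm set \<Rightarrow> bool" where
  "consistent T \<Delta> \<longleftrightarrow> (\<forall>\<Gamma>. set \<Gamma> \<subseteq> \<Delta> \<longrightarrow> \<not> deriv T \<Gamma> Bot)"

definition qf :: "fm \<Rightarrow> bool" where
  "qf p \<longleftrightarrow> wf_fm p \<and> quantifier_free p"

lemma qf_simps [simp]:
  "qf Bot" "qf (s \<^bold>= t) \<longleftrightarrow> wf_tm s \<and> wf_tm t" "qf (p \<^bold>\<longrightarrow> q) \<longleftrightarrow> qf p \<and> qf q" "\<not> qf (Forall p)"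
  by (auto simp: qf_def)

lemma qf_subst: "qf p \<Longrightarrow> (\<And>i. wf_tm (\<sigma> i)) \<Longrightarrow> qf (subst_fm \<sigma> p)"
  by (simp add: qf_def wf_subst_fm)

text \<open>Only quantifier-free formulas are decided, so no Henkin witnesses are called
  for.\<close>

definition complete_for :: "fm set \<Rightarrow> fm set \<Rightarrow> bool" where
  "complete_for T S \<longleftrightarrow> consistent T S \<and> (\<forall>p \<in> S. qf p) \<and> (\<forall>p. qf p \<longrightarrow> p \<in> S \<or> Neg p \<in> S)"

lemma inconsistent_insert:
  assumes "\<not> consistent T (insert p S)" "wf_fm p"
  obtains \<Gamma> where "set \<Gamma> \<subseteq> S" "deriv T \<Gamma> (Neg p)"
proof -
  obtain \<Gamma> where \<Gamma>: "set \<Gamma> \<subseteq> insert p S" "deriv T \<Gamma> Bot"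
    using assms(1) unfolding consistent_def by blast
  let ?\<Gamma> = "filter (\<lambda>q. q \<noteq> p) \<Gamma>"
  have "deriv T (p # ?\<Gamma>) Bot" by (rule deriv_weaken[OF \<Gamma>(2)]) auto
  then have "deriv T ?\<Gamma> (Neg p)" using assms(2) by (rule imp_I[rotated])
  moreover have "set ?\<Gamma> \<subseteq> S" using \<Gamma>(1) by auto
  ultimately show ?thesis by (rule that[rotated])
qed

text \<open>Zorn's lemma gives a maximal consistent extension. If it contained neither
  \<open>p\<close> nor \<open>Neg p\<close>, adding either would be inconsistent, and the two
  refutations would combine into one of the set itself.\<close>

lemma Lindenbaum:
  assumes "consistent T \<Delta>" "\<forall>p \<in> \<Delta>. qf p"
  obtains S where "\<Delta> \<subseteq> S" "complete_for T S"
proof -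
  let ?A = "{S. \<Delta> \<subseteq> S \<and> consistent T S \<and> S \<subseteq> {p. qf p}}"
  have "\<exists>M \<in> ?A. \<forall>X \<in> ?A. M \<subseteq> X \<longrightarrow> X = M"
  proof (rule subset_Zorn_nonempty)
    show "?A \<noteq> {}" using assms by auto
    fix C assume C: "C \<noteq> {}" "subset.chain ?A C"
    have "consistent T (\<Union> C)"
      unfolding consistent_def
    proof (intro allI impI)
      \<comment> \<open>A derivation has finitely many assumptions, which therefore lie in one
        member of the chain.\<close>
      fix \<Gamma> assume "set \<Gamma> \<subseteq> \<Union> C"
      then obtain X where "X \<in> C" "set \<Gamma> \<subseteq> X"
        using finite_subset_Union_chain[of "set \<Gamma>" C ?A] C by blast
      then show "\<not> deriv T \<Gamma> Bot"
        using C(2) unfolding subset.chain_def consistent_def by blast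
    qed
    then show "\<Union> C \<in> ?A" using C unfolding subset.chain_def by blast
  qed
  then obtain S where "S \<in> ?A" and max: "\<And>X. X \<in> ?A \<Longrightarrow> S \<subseteq> X \<Longrightarrow> X = S"
    by (elim bexE) simp
  then have S: "\<Delta> \<subseteq> S" "consistent T S" "\<forall>p \<in> S. qf p" by auto
  have "p \<in> S \<or> Neg p \<in> S" if "qf p" for p
  proof (rule ccontr)
    assume *: "\<not> (p \<in> S \<or> Neg p \<in> S)"
    have wf: "wf_fm p" "wf_fm (Neg p)" using that by (auto simp: qf_def)
    have "\<not> consistent T (insert p S)"
    proof
      assume "consistent T (insert p S)"
      then have "insert p S = S" using S that by (intro max) auto
      with * show False by blast
    qed
    then obtain \<Gamma> where \<Gamma>: "set \<Gamma> \<subseteq> S" "deriv T \<Gamma> (Neg p)"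
      using wf(1) by (rule inconsistent_insert)
    have "\<not> consistent T (insert (Neg p) S)"
    proof
      assume "consistent T (insert (Neg p) S)"
      then have "insert (Neg p) S = S" using S that by (intro max) auto
      with * show False by blast
    qed
    then obtain \<Gamma>' where \<Gamma>': "set \<Gamma>' \<subseteq> S" "deriv T \<Gamma>' (Neg (Neg p))"
      using wf(2) by (rule inconsistent_insert)
    have "deriv T (\<Gamma> @ \<Gamma>') (Neg p)" by (rule deriv_weaken[OF \<Gamma>(2)]) simp
    moreover have "deriv T (\<Gamma> @ \<Gamma>') (Neg (Neg p))" by (rule deriv_weaken[OF \<Gamma>'(2)]) simp
    ultimately have "deriv T (\<Gamma> @ \<Gamma>') Bot" by (rule imp_E[rotated])
    moreover have "set (\<Gamma> @ \<Gamma>') \<subseteq> S" using \<Gamma> \<Gamma>' by simp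
    ultimately show False using S(2) unfolding consistent_def by blast
  qed
  with S show ?thesis by (intro that) (auto simp: complete_for_def)
qed

lemma complete_forD: "complete_for T S \<Longrightarrow> deriv T \<Gamma> Bot \<Longrightarrow> set \<Gamma> \<subseteq> S \<Longrightarrow> False"
  unfolding complete_for_def consistent_def by blast

lemma complete_for_closed:
  assumes "complete_for T S" "deriv T \<Gamma> p" "set \<Gamma> \<subseteq> S" "qf p"
  shows "p \<in> S"
proof (rule ccontr)
  assume "p \<notin> S"
  then have Neg: "Neg p \<in> S" "wf_fm (Neg p)" using assms(1,4) by (auto simp: complete_for_def qf_def)
  have "deriv T (Neg p # \<Gamma>) p" by (rule deriv_weaken[OF assms(2)]) auto
  moreover have "deriv T (Neg p # \<Gamma>) (Neg p)" using Neg by (intro assm) auto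
  ultimately have "deriv T (Neg p # \<Gamma>) Bot" by (rule imp_E[rotated])
  then show False
    using complete_forD[OF assms(1), of "Neg p # \<Gamma>"] assms(3) Neg by simp
qed

lemma deriv_Neg_E: "wf_fm p \<Longrightarrow> p \<in> set \<Gamma> \<Longrightarrow> Neg p \<in> set \<Gamma> \<Longrightarrow> deriv T \<Gamma> Bot"
  by (rule imp_E[of _ _ p]; rule assm) auto

lemma complete_for_Neg:
  assumes "complete_for T S" "qf p"
  shows "Neg p \<in> S \<longleftrightarrow> p \<notin> S"
proof
  assume "Neg p \<in> S"
  moreover have "deriv T [Neg p, p] Bot"
    by (rule deriv_Neg_E[of p]) (use assms(2) in \<open>auto simp: qf_def\<close>)
  ultimately show "p \<notin> S"
    using complete_forD[OF assms(1), of "[Neg p, p]"] by auto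
qed (use assms in \<open>auto simp: complete_for_def\<close>)

lemma complete_for_Imp:
  assumes "complete_for T S" "qf p" "qf q"
  shows "(p \<^bold>\<longrightarrow> q) \<in> S \<longleftrightarrow> (p \<in> S \<longrightarrow> q \<in> S)"
proof
  assume *: "(p \<^bold>\<longrightarrow> q) \<in> S"
  have "deriv T [p \<^bold>\<longrightarrow> q, p] q"
    by (rule imp_E[of _ _ p]; rule assm) (use assms in \<open>auto simp: qf_def\<close>)
  then show "p \<in> S \<longrightarrow> q \<in> S"
    using assms(3) * by (auto dest: complete_for_closed[OF assms(1), of "[p \<^bold>\<longrightarrow> q, p]"])
next
  assume "p \<in> S \<longrightarrow> q \<in> S"
  then consider "Neg p \<in> S" | "q \<in> S" using complete_for_Neg[OF assms(1,2)] by blast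
  then show "(p \<^bold>\<longrightarrow> q) \<in> S"
  proof cases
    case 1
    have "deriv T [p, Neg p] Bot"
      by (rule deriv_Neg_E[of p]) (use assms(2) in \<open>auto simp: qf_def\<close>)
    then have "deriv T [p, Neg p] q"
      by (rule deriv_Bot_E) (use assms in \<open>auto simp: qf_def\<close>)
    then have "deriv T [Neg p] (p \<^bold>\<longrightarrow> q)"
      using assms by (auto simp: qf_def intro: imp_I)
    then show ?thesis using complete_for_closed[OF assms(1), of "[Neg p]"] 1 assms by simp
  next
    case 2
    have "deriv T [q] (p \<^bold>\<longrightarrow> q)"
      by (rule imp_I[OF _ assm]) (use assms in \<open>auto simp: qf_def\<close>)
    then show ?thesis using complete_for_closed[OF assms(1), of "[q]"] 2 assms by simp
  qed
qed

instance efun :: countable by countable_datatype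
instance tm :: countable by countable_datatype

text \<open>
  The universe is all of \<open>nat\<close> without loss of generality, because a term model has countably
  infinitely many elements; the functions need not be the standard ones.
\<close>

definition ea_model :: "(efun \<Rightarrow> nat list \<Rightarrow> nat) \<Rightarrow> bool" where
  "ea_model F \<longleftrightarrow> (\<forall>p v. qf p \<longrightarrow> EA \<turnstile> p \<longrightarrow> sat F v p)"

lemma EA_subst: "p \<in> EA \<Longrightarrow> (\<And>i. wf_tm (\<sigma> i)) \<Longrightarrow> EA \<turnstile> subst_fm \<sigma> p"
  using provable_subst[of EA 0 p \<sigma>] by (simp add: provable_def axm)

lemma elem_code_simps [simp]:
  "elem_code n CZero \<longleftrightarrow> n = 0" "elem_code n CSucc \<longleftrightarrow> n = Suc 0" "elem_code n CPred \<longleftrightarrow> n = Suc 0"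
  "elem_code n (CProj m i) \<longleftrightarrow> n = m \<and> i < m"
  "elem_code n CAdd \<longleftrightarrow> n = Suc (Suc 0)" "elem_code n CMul \<longleftrightarrow> n = Suc (Suc 0)"
  "elem_code n CMonus \<longleftrightarrow> n = Suc (Suc 0)"
  "elem_code n (CComp m f gs) \<longleftrightarrow> n = m \<and> elem_code (length gs) f \<and> (\<forall>g \<in> set gs. elem_code m g)"
  "elem_code n (CSum g) \<longleftrightarrow> n \<noteq> 0 \<and> elem_code n g"
  "elem_code n (CProd g) \<longleftrightarrow> n \<noteq> 0 \<and> elem_code n g"
  by (auto simp: elem_code.simps[of n CZero] elem_code.simps[of n CSucc] elem_code.simps[of n CPred]
      elem_code.simps[of n "CProj m i"] elem_code.simps[of n CAdd] elem_code.simps[of n CMul]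
      elem_code.simps[of n CMonus] elem_code.simps[of n "CComp m f gs"]
      elem_code.simps[of n "CSum g"] elem_code.simps[of n "CProd g"] dest: gr0_implies_Suc)

lemma wf_numeral [simp]: "wf_tm (numeral_tm n)"
  by (induction n) auto

text \<open>The two successor axioms refute every equation between different numerals. This makes
  the term model infinite.\<close>

lemma numerals_distinct:
  assumes "complete_for EA S" "(numeral_tm m \<^bold>= numeral_tm n) \<in> S"
  shows "m = n"
  using assms(2)
proof (induction m arbitrary: n)
  note closed = complete_for_closed[OF assms(1)]
  have nz: "(Succ (numeral_tm k) \<^bold>= Zero) \<notin> S" for k
  proof -
    have "EA \<turnstile> Neg (Succ (numeral_tm k) \<^bold>= Zero)"
      using EA_subst[OF succ_nonzero, of "\<lambda>_. numeral_tm k"] by simp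
    then have "Neg (Succ (numeral_tm k) \<^bold>= Zero) \<in> S"
      using closed[of "[]" "Neg (Succ (numeral_tm k) \<^bold>= Zero)"] unfolding provable_def by simp
    then show ?thesis using complete_for_Neg[OF assms(1)] by simp
  qed
  {
    case 0
    have "n \<noteq> Suc k" for k
    proof
      assume "n = Suc k"
      moreover have "deriv EA [Zero \<^bold>= Succ (numeral_tm k)] (Succ (numeral_tm k) \<^bold>= Zero)"
        by (rule deriv_sym) (auto intro: assm)
      ultimately show False
        using nz[of k] 0 closed[of "[Zero \<^bold>= Succ (numeral_tm k)]"] by simp
    qed
    then show ?case by (cases n) auto
  next
    case (Suc m)
    then obtain k where k: "n = Suc k" using nz by (cases n) auto
    have "EA \<turnstile> (Succ (numeral_tm m) \<^bold>= Succ (numeral_tm k) \<^bold>\<longrightarrow> numeral_tm m \<^bold>= numeral_tm k)"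
      using EA_subst[OF succ_inj, of "case_nat (numeral_tm m) (\<lambda>_. numeral_tm k)"]
      by (simp split: nat.split)
    then have "(numeral_tm m \<^bold>= numeral_tm k) \<in> S"
      using closed[of "[]" "Succ (numeral_tm m) \<^bold>= Succ (numeral_tm k) \<^bold>\<longrightarrow> numeral_tm m \<^bold>= numeral_tm k"]
        complete_for_Imp[OF assms(1), of "Succ (numeral_tm m) \<^bold>= Succ (numeral_tm k)"] Suc.prems k
      unfolding provable_def by simp
    then show ?case using Suc.IH k by simp
  }
qed

section \<open>The term model of a complete set\<close>

locale term_model =
  fixes S :: "fm set"
  assumes complete: "complete_for EA S"
begin

definition cls :: "tm \<Rightarrow> tm set" where
  "cls s = {t. wf_tm t \<and> (s \<^bold>= t) \<in> S}"

lemma cls_eq_iff: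
  assumes "wf_tm s" "wf_tm t"
  shows "cls s = cls t \<longleftrightarrow> (s \<^bold>= t) \<in> S"
proof
  have "(t \<^bold>= t) \<in> S"
    using complete_for_closed[OF complete, of "[]"] assms by (simp add: eq_refl)
  moreover assume "cls s = cls t"
  ultimately show "(s \<^bold>= t) \<in> S" using assms unfolding cls_def by blast
next
  assume *: "(s \<^bold>= t) \<in> S"
  have "(s \<^bold>= r) \<in> S \<longleftrightarrow> (t \<^bold>= r) \<in> S" if "wf_tm r" for r
  proof
    assume "(s \<^bold>= r) \<in> S"
    moreover have "deriv EA [s \<^bold>= t, s \<^bold>= r] (t \<^bold>= r)"
      by (rule deriv_trans[OF deriv_sym[of _ _ s t]]) (use that assms in \<open>auto intro: assm\<close>)
    ultimately show "(t \<^bold>= r) \<in> S"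
      using complete_for_closed[OF complete, of "[s \<^bold>= t, s \<^bold>= r]"] * that assms by simp
  next
    assume "(t \<^bold>= r) \<in> S"
    moreover have "deriv EA [s \<^bold>= t, t \<^bold>= r] (s \<^bold>= r)"
      by (rule deriv_trans[of _ _ s t]) (use that assms in \<open>auto intro: assm\<close>)
    ultimately show "(s \<^bold>= r) \<in> S"
      using complete_for_closed[OF complete, of "[s \<^bold>= t, t \<^bold>= r]"] * that assms by simp
  qed
  then show "cls s = cls t" unfolding cls_def by blast
qed

definition elt :: "tm \<Rightarrow> nat" where
  "elt t = to_nat_on (cls ` {t. wf_tm t}) (cls t)"

text \<open>There are countably many terms and, by the numerals, infinitely many classes; hence
  numbering the classes exhausts \<open>nat\<close>.\<close>

lemma bij_to_nat: "bij_betw (to_nat_on (cls ` {t. wf_tm t})) (cls ` {t. wf_tm t}) UNIV"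
proof (rule to_nat_on_infinite)
  show "countable (cls ` {t. wf_tm t})" by (rule countable_image) simp
  have "inj (\<lambda>n. cls (numeral_tm n))"
    by (rule injI) (auto simp: cls_eq_iff intro: numerals_distinct[OF complete])
  then have "infinite (range (\<lambda>n. cls (numeral_tm n)))" by (rule range_inj_infinite)
  moreover have "range (\<lambda>n. cls (numeral_tm n)) \<subseteq> cls ` {t. wf_tm t}" by auto
  ultimately show "infinite (cls ` {t. wf_tm t})" using finite_subset by blast
qed

lemma elt_eq_iff:
  assumes "wf_tm s" "wf_tm t"
  shows "elt s = elt t \<longleftrightarrow> (s \<^bold>= t) \<in> S"
proof -
  have "elt s = elt t \<longleftrightarrow> cls s = cls t"
    unfolding elt_def using bij_to_nat assms by (auto simp: bij_betw_def inj_on_def)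
  then show ?thesis using cls_eq_iff assms by simp
qed

lemma elt_surj: "\<exists>t. wf_tm t \<and> elt t = n"
proof -
  have "n \<in> to_nat_on (cls ` {t. wf_tm t}) ` (cls ` {t. wf_tm t})"
    using bij_to_nat by (simp add: bij_betw_def)
  then show ?thesis unfolding elt_def by blast
qed

definition rep :: "nat \<Rightarrow> tm" where
  "rep n = (SOME t. wf_tm t \<and> elt t = n)"

lemma rep: "wf_tm (rep n)" "elt (rep n) = n"
  using someI_ex[OF elt_surj[of n]] by (auto simp: rep_def)

definition interp :: "efun \<Rightarrow> nat list \<Rightarrow> nat" where
  "interp f xs = elt (Fn f (map rep xs))"

text \<open>Congruence makes the interpretation independent of the chosen representatives.\<close>

lemma interp_elt:
  assumes "wf_tm (Fn f ts)"
  shows "interp f (map elt ts) = elt (Fn f ts)"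
proof -
  let ?eqs = "map (\<lambda>t. rep (elt t) \<^bold>= t) ts"
  have wf: "wf_tm (Fn f (map (rep \<circ> elt) ts))" using assms rep by auto
  have "deriv EA ?eqs (Fn f ([] @ map (rep \<circ> elt) ts) \<^bold>= Fn f ([] @ ts))"
  proof (rule deriv_cong)
    show "list_all2 (\<lambda>s t. deriv EA ?eqs (s \<^bold>= t)) (map (rep \<circ> elt) ts) ts"
      unfolding list_all2_conv_all_nth using assms rep by (auto intro!: assm)
  qed (use assms wf in auto)
  moreover have "set ?eqs \<subseteq> S"
    using assms rep by (auto simp: elt_eq_iff[symmetric])
  ultimately have "(Fn f (map (rep \<circ> elt) ts) \<^bold>= Fn f ts) \<in> S"
    using complete_for_closed[OF complete, of ?eqs] assms wf by simp
  then show ?thesis using elt_eq_iff[OF wf assms] by (simp add: interp_def)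
qed

lemma eval_interp:
  assumes "wf_tm t" "\<And>i. wf_tm (\<sigma> i)"
  shows "eval interp (\<lambda>i. elt (\<sigma> i)) t = elt (subst_tm \<sigma> t)"
  using assms(1)
proof (induction t)
  case (Fn f ts)
  then have "map (eval interp (\<lambda>i. elt (\<sigma> i))) ts = map elt (map (subst_tm \<sigma>) ts)" by simp
  moreover have "wf_tm (Fn f (map (subst_tm \<sigma>) ts))"
    using wf_subst_tm[of "Fn f ts", OF Fn.prems assms(2)] by simp
  ultimately show ?case using interp_elt by (simp del: map_map map_eq_conv)
qed simp

text \<open>The truth lemma. Every element is the class of a term, so substitutions can stand in for
  valuations; the induction uses that \<open>S\<close> respects implication.\<close>

lemma sat_interp:
  assumes "qf p" "\<And>i. wf_tm (\<sigma> i)"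
  shows "sat interp (\<lambda>i. elt (\<sigma> i)) p \<longleftrightarrow> subst_fm \<sigma> p \<in> S"
  using assms(1)
proof (induction p)
  case Bot
  have "Bot \<notin> S"
    using complete_forD[OF complete, of "[Bot]"] assm[of Bot "[Bot]"] by auto
  then show ?case by simp
next
  case (Eq s t)
  then show ?case using assms(2) by (simp add: eval_interp elt_eq_iff wf_subst_tm)
next
  case (Imp p q)
  then show ?case using assms(2) complete_for_Imp[OF complete] by (simp add: qf_subst)
qed simp

lemma ea_model_interp: "ea_model interp"
  unfolding ea_model_def
proof (intro allI impI)
  fix p and v :: "nat \<Rightarrow> nat" assume p: "qf p" "EA \<turnstile> p"
  have "EA \<turnstile> subst_fm (\<lambda>i. rep (v i)) p" using provable_subst[of EA 0] p rep by simp
  then have "subst_fm (\<lambda>i. rep (v i)) p \<in> S"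
    using complete_for_closed[OF complete, of "[]"] p rep by (simp add: provable_def qf_subst)
  then show "sat interp v p" using sat_interp[OF p(1), of "\<lambda>i. rep (v i)"] rep by simp
qed

end

text \<open>Each variable is sent to its own class, so a term evaluates to its class and the model
  is generated by terms. Herbrand's theorem rests on this last property.\<close>

theorem consistent_has_term_model:
  assumes "consistent EA \<Delta>" "\<forall>p \<in> \<Delta>. qf p"
  obtains F v where "ea_model F" "\<forall>p \<in> \<Delta>. sat F v p" "\<And>a. \<exists>t. wf_tm t \<and> eval F v t = a"
proof -
  obtain S where S: "\<Delta> \<subseteq> S" "complete_for EA S" using Lindenbaum[OF assms] .
  interpret term_model S by unfold_locales fact
  show ?thesis
  proof
    show "ea_model interp" by (rule ea_model_interp)
    show "\<forall>p \<in> \<Delta>. sat interp (\<lambda>i. elt (Var i)) p"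
      using assms(2) S(1) sat_interp[of _ Var] by auto
    show "\<exists>t. wf_tm t \<and> eval interp (\<lambda>i. elt (Var i)) t = a" for a
      using elt_surj[of a] eval_interp[of _ Var] by auto
  qed
qed

text \<open>Otherwise \<open>Neg p\<close> would be consistent and a term model would refute
  \<open>p\<close>. From here on, provability of quantifier-free formulas is shown by reasoning in
  models.\<close>

theorem qf_completeness:
  assumes "qf p" "\<And>F v. ea_model F \<Longrightarrow> sat F v p"
  shows "EA \<turnstile> p"
proof -
  have "\<not> consistent EA {Neg p}"
  proof
    assume "consistent EA {Neg p}"
    moreover have "\<forall>q \<in> {Neg p}. qf q" using assms(1) by simp
    ultimately obtain F v where "ea_model F" "\<forall>q \<in> {Neg p}. sat F v q"
      by (rule consistent_has_term_model)
    then show False using assms(2)[of F v] by simp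
  qed
  then obtain \<Gamma> where "set \<Gamma> \<subseteq> {Neg p}" "deriv EA \<Gamma> Bot" unfolding consistent_def by blast
  then have "deriv EA [Neg p] Bot" using deriv_weaken[of EA \<Gamma> Bot "[Neg p]"] by simp
  then show ?thesis using assms(1) by (auto simp: provable_def qf_def intro: contra)
qed

section \<open>Arithmetic in models\<close>

lemma map_nth_tl: "length xs = n \<Longrightarrow> map ((!) (a # xs)) [Suc 0..<Suc n] = xs"
  using map_nth[of xs] by (simp add: map_Suc_upt[symmetric] comp_def del: upt_Suc)

locale model =
  fixes F :: "efun \<Rightarrow> nat list \<Rightarrow> nat"
  assumes ea_model: "ea_model F"
begin

abbreviation "zr \<equiv> F CZero []"
abbreviation "sc a \<equiv> F CSucc [a]"
abbreviation "pd a \<equiv> F CPred [a]"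
abbreviation "ad a b \<equiv> F CAdd [a, b]"
abbreviation "ml a b \<equiv> F CMul [a, b]"
abbreviation "mo a b \<equiv> F CMonus [a, b]"

lemma sat_EA_qf: "p \<in> EA \<Longrightarrow> qf p \<Longrightarrow> sat F v p"
  using ea_model by (auto simp: ea_model_def provable_def intro: axm)

lemma sc_nonzero [simp]: "sc a \<noteq> zr"
  using sat_EA_qf[OF succ_nonzero, of "\<lambda>_. a"] by simp

lemma zr_nonsc [simp]: "zr \<noteq> sc a"
  using sc_nonzero[of a] by metis

lemma sc_inject [simp]: "sc a = sc b \<longleftrightarrow> a = b"
  using sat_EA_qf[OF succ_inj, of "case_nat a (\<lambda>_. b)"] by auto

lemma pd_simps [simp]: "pd zr = zr" "pd (sc a) = a"
  using sat_EA_qf[OF pred_zero, of "\<lambda>_. a"] sat_EA_qf[OF pred_succ, of "\<lambda>_. a"] by auto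

lemma ad_simps [simp]: "ad a zr = a" "ad a (sc b) = sc (ad a b)"
  using sat_EA_qf[OF add_zero, of "\<lambda>_. a"] sat_EA_qf[OF add_succ, of "case_nat a (\<lambda>_. b)"] by auto

lemma ml_simps [simp]: "ml a zr = zr" "ml a (sc b) = ad (ml a b) a"
  using sat_EA_qf[OF mul_zero, of "\<lambda>_. a"] sat_EA_qf[OF mul_succ, of "case_nat a (\<lambda>_. b)"] by auto

lemma mo_simps [simp]: "mo a zr = a" "mo a (sc b) = pd (mo a b)"
  using sat_EA_qf[OF monus_zero, of "\<lambda>_. a"] sat_EA_qf[OF monus_succ, of "case_nat a (\<lambda>_. b)"] by auto

lemma proj: "i < length xs \<Longrightarrow> F (CProj (length xs) i) xs = xs ! i"
  using sat_EA_qf[OF EA.proj, of i "length xs" "(!) xs"] by (simp add: comp_def map_nth)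

lemma comp:
  "elem_code (length xs) (CComp (length xs) f gs) \<Longrightarrow>
    F (CComp (length xs) f gs) xs = F f (map (\<lambda>g. F g xs) gs)"
  using sat_EA_qf[OF EA.comp, of "length xs" f gs "(!) xs"] by (simp add: comp_def map_nth)

lemma sum_zr: "elem_code (Suc (length ys)) g \<Longrightarrow> F (CSum g) (zr # ys) = zr"
  using sat_EA_qf[OF EA.sum_zero, of "length ys" g "(!) (zr # ys)"]
    map_nth_tl[of ys "length ys" zr] by (simp add: comp_def del: upt_Suc)

lemma prod_zr: "elem_code (Suc (length ys)) g \<Longrightarrow> F (CProd g) (zr # ys) = sc zr"
  using sat_EA_qf[OF EA.prod_zero, of "length ys" g "(!) (zr # ys)"]
    map_nth_tl[of ys "length ys" zr] by (simp add: comp_def del: upt_Suc)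

lemma sum_sc: "elem_code (Suc (length ys)) g \<Longrightarrow>
    F (CSum g) (sc a # ys) = ad (F (CSum g) (a # ys)) (F g (a # ys))"
  using sat_EA_qf[OF EA.sum_succ, of "length ys" g "(!) (a # ys)"]
    map_nth_tl[of ys "length ys" a] map_nth[of "a # ys"] by (simp add: comp_def del: upt_Suc)

lemma prod_sc: "elem_code (Suc (length ys)) g \<Longrightarrow>
    F (CProd g) (sc a # ys) = ml (F (CProd g) (a # ys)) (F g (a # ys))"
  using sat_EA_qf[OF EA.prod_succ, of "length ys" g "(!) (a # ys)"]
    map_nth_tl[of ys "length ys" a] map_nth[of "a # ys"] by (simp add: comp_def del: upt_Suc)

end

text \<open>
  Models are only required to satisfy the quantifier-free consequences of \<open>EA\<close>, so at first induction
  is available as a rule, for formulas valid in all models at once.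
\<close>

lemma induction_rule:
  assumes "qf p" "\<And>F v. model F \<Longrightarrow> sat F (case_nat (F CZero []) v) p"
    and "\<And>F a v. model F \<Longrightarrow> sat F (case_nat a v) p \<Longrightarrow> sat F (case_nat (F CSucc [a]) v) p"
    and "model F"
  shows "sat F v p"
proof -
  let ?s = "subst_fm (case_nat (Succ (Var 0)) (\<lambda>i. Var (Suc i))) p"
  \<comment> \<open>Base and step hold in all models, so completeness turns them into theorems, and
    the induction axiom applies inside \<open>EA\<close>.\<close>
  have "EA \<turnstile> inst p Zero"
  proof (rule qf_completeness)
    show "qf (inst p Zero)" by (rule qf_subst) (use assms(1) in \<open>auto split: nat.split\<close>)
    show "sat F v (inst p Zero)" if "ea_model F" for F v
      using assms(2)[of F v] that by (simp add: sat_subst eval_case_nat model_def)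
  qed
  moreover have "EA \<turnstile> p \<^bold>\<longrightarrow> ?s"
  proof (rule qf_completeness)
    show "qf (p \<^bold>\<longrightarrow> ?s)" using assms(1) by (auto intro: qf_subst split: nat.split)
    show "sat F v (p \<^bold>\<longrightarrow> ?s)" if "ea_model F" for F v
    proof -
      have v: "case_nat (v 0) (\<lambda>i. v (Suc i)) = v" by (auto split: nat.split)
      show ?thesis
        using assms(3)[of F "v 0" "\<lambda>i. v (Suc i)"] that by (simp add: sat_subst eval_case_nat model_def v)
    qed
  qed
  moreover have "EA \<turnstile> (inst p Zero \<^bold>\<longrightarrow> Forall (p \<^bold>\<longrightarrow> ?s) \<^bold>\<longrightarrow> Forall p)"
    using assms(1) by (auto simp: provable_def qf_def intro: axm EA.induction)
  ultimately have "EA \<turnstile> Forall p"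
    unfolding provable_def using imp_E[OF imp_E] all_I[of EA "[]"] by simp
  then have "EA \<turnstile> p" using provable_subst[of EA 1 p Var] by simp
  then show ?thesis using assms(1,4) by (simp add: model_def ea_model_def)
qed

context model
begin

text \<open>The predecessor names the witness, which keeps the case distinction quantifier-free and
  so provable by induction.\<close>

lemma zr_or_sc: "x \<noteq> zr \<Longrightarrow> x = sc (pd x)"
proof -
  have "sat F (\<lambda>_. x) (Neg (Var 0 \<^bold>= Zero) \<^bold>\<longrightarrow> Var 0 \<^bold>= Succ (Pred (Var 0)))"
  proof (rule induction_rule)
    fix F :: "efun \<Rightarrow> nat list \<Rightarrow> nat" and a v assume "model F"
    then interpret M: model F .
    show "sat F (case_nat M.zr v) (Neg (Var 0 \<^bold>= Zero) \<^bold>\<longrightarrow> Var 0 \<^bold>= Succ (Pred (Var 0)))"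
      and "sat F (case_nat (M.sc a) v) (Neg (Var 0 \<^bold>= Zero) \<^bold>\<longrightarrow> Var 0 \<^bold>= Succ (Pred (Var 0)))"
      by simp_all
  qed (simp, rule model_axioms)
  then show "x \<noteq> zr \<Longrightarrow> x = sc (pd x)" by simp
qed

lemma nat_cases: obtains "x = zr" | y where "x = sc y"
  using zr_or_sc by metis

lemma mo_sc_sc: "mo (sc x) (sc y) = mo x y"
proof -
  let ?p = "Monus (Succ (Var 1)) (Succ (Var 0)) \<^bold>= Monus (Var 1) (Var 0)"
  have "sat F (case_nat y (\<lambda>_. x)) ?p"
  proof (rule induction_rule)
    fix F :: "efun \<Rightarrow> nat list \<Rightarrow> nat" and a v assume "model F"
    then interpret M: model F .
    show "sat F (case_nat M.zr v) ?p" by simp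
    show "sat F (case_nat a v) ?p \<Longrightarrow> sat F (case_nat (M.sc a) v) ?p" by simp
  qed (simp, rule model_axioms)
  then show ?thesis by simp
qed

lemma mo_self [simp]: "mo x x = zr"
proof -
  let ?p = "Monus (Var 0) (Var 0) \<^bold>= Zero"
  have "sat F (\<lambda>_. x) ?p"
  proof (rule induction_rule)
    fix F :: "efun \<Rightarrow> nat list \<Rightarrow> nat" and a v assume "model F"
    then interpret M: model F .
    show "sat F (case_nat M.zr v) ?p" by simp
    \<comment> \<open>The recursion equations are removed so that the common successor is cancelled
      instead of unfolded.\<close>
    show "sat F (case_nat a v) ?p \<Longrightarrow> sat F (case_nat (M.sc a) v) ?p"
      using M.mo_sc_sc by (simp del: M.mo_simps)
  qed (simp, rule model_axioms)
  then show ?thesis by simp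
qed

lemma mo_zr_left [simp]: "mo zr x = zr"
proof -
  let ?p = "Monus Zero (Var 0) \<^bold>= Zero"
  have "sat F (\<lambda>_. x) ?p"
  proof (rule induction_rule)
    fix F :: "efun \<Rightarrow> nat list \<Rightarrow> nat" and a v assume "model F"
    then interpret M: model F .
    show "sat F (case_nat M.zr v) ?p" by simp
    show "sat F (case_nat a v) ?p \<Longrightarrow> sat F (case_nat (M.sc a) v) ?p" by simp
  qed (simp, rule model_axioms)
  then show ?thesis by simp
qed

text \<open>Vanishing differences force both elements to be zero or both to be successors, and in
  the latter case predecessors determine them.\<close>

lemma mo_antisym_step:
  assumes "mo (pd a) (pd b) = zr \<Longrightarrow> mo (pd b) (pd a) = zr \<Longrightarrow> pd a = pd b"
    and "mo a b = zr" "mo b a = zr"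
  shows "a = b"
proof (cases a rule: nat_cases)
  case 1
  then show ?thesis using assms(3) by simp
next
  case a: (2 a')
  show ?thesis
  proof (cases b rule: nat_cases)
    case 1
    then show ?thesis using assms(2) by simp
  next
    case (2 b')
    then show ?thesis using assms a by (simp add: mo_sc_sc del: mo_simps)
  qed
qed

text \<open>Downward induction on \<open>n\<close>, in contrapositive form, with the statement for \<open>x - n\<close> and \<open>y - n\<close>.\<close>

lemma mo_antisym:
  assumes "mo x y = zr" "mo y x = zr"
  shows "x = y"
proof -
  let ?q = "\<lambda>s t. Monus s t \<^bold>= Zero \<^bold>\<longrightarrow> Monus t s \<^bold>= Zero \<^bold>\<longrightarrow> s \<^bold>= t"
  let ?p = "Neg (?q (Var 1) (Var 2)) \<^bold>\<longrightarrow> Neg (?q (Monus (Var 1) (Var 0)) (Monus (Var 2) (Var 0)))"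
  \<comment> \<open>At \<open>n = x\<close> both \<open>x - n\<close> and \<open>y - n\<close> are
    zero, the latter by hypothesis, so the statement is trivial there and returns to
    \<open>x\<close> and \<open>y\<close>.\<close>
  have "sat F (case_nat x (case_nat x (\<lambda>_. y))) ?p"
  proof (rule induction_rule)
    fix F :: "efun \<Rightarrow> nat list \<Rightarrow> nat" and a v assume "model F"
    then interpret M: model F .
    show "sat F (case_nat M.zr v) ?p" by simp
    show "sat F (case_nat a v) ?p \<Longrightarrow> sat F (case_nat (M.sc a) v) ?p"
      using M.mo_antisym_step[of "M.mo (v 0) a" "M.mo (v 1) a"] by (auto simp: numeral_2_eq_2)
  qed (simp, rule model_axioms)
  then show ?thesis using assms by (auto simp: numeral_2_eq_2)
qed

lemma ad_eq_zr: "ad x y = zr \<longleftrightarrow> x = zr \<and> y = zr"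
  by (cases y rule: nat_cases) auto

lemma mo_one: "mo (sc zr) x = (if x = zr then sc zr else zr)"
  by (cases x rule: nat_cases) (auto simp: mo_sc_sc simp del: mo_simps(2))

end

section \<open>Bounded search\<close>

text \<open>The characteristic term, with one for true. The sum of the two truncated differences
  vanishes only on equality, and \<open>chi p - chi q\<close> is nonzero only if \<open>p\<close>
  holds and \<open>q\<close> fails. The value at \<open>Forall\<close> is a default.\<close>

primrec chi :: "fm \<Rightarrow> tm" where
  "chi Bot = Zero"
| "chi (s \<^bold>= t) = Monus (Succ Zero) (Add (Monus s t) (Monus t s))"
| "chi (p \<^bold>\<longrightarrow> q) = Monus (Succ Zero) (Monus (chi p) (chi q))"
| "chi (Forall p) = Zero"

lemma wf_chi: "qf p \<Longrightarrow> wf_tm (chi p)"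
  by (induction p) auto

lemma vars_chi: "quantifier_free p \<Longrightarrow> vars_tm (chi p) = free_vars p"
  by (induction p) auto

lemma (in model) eval_chi: "qf p \<Longrightarrow> eval F v (chi p) = (if sat F v p then sc zr else zr)"
proof (induction p)
  case (Eq s t)
  then show ?case by (auto simp: mo_one ad_eq_zr mo_antisym)
next
  case (Imp p q)
  then show ?case by (auto simp: mo_one)
qed auto

text \<open>Bounded sums and products apply to codes, not to terms; this turns a term in the
  variables below \<open>n\<close> into an \<open>n\<close>-ary code.\<close>

fun code :: "nat \<Rightarrow> tm \<Rightarrow> efun" where
  "code n (Var i) = CProj n i"
| "code n (Fn f ts) = CComp n f (map (code n) ts)"

lemma elem_code_code: "wf_tm t \<Longrightarrow> vars_tm t \<subseteq> {..<n} \<Longrightarrow> elem_code n (code n t)"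
  by (induction t) auto

lemma (in model) interp_code:
  assumes "wf_tm t" "vars_tm t \<subseteq> {..<length xs}"
  shows "F (code (length xs) t) xs = eval F ((!) xs) t"
  using assms
proof (induction t)
  case (Var i)
  then show ?case by (simp add: proj)
next
  case (Fn f ts)
  have "elem_code (length xs) (code (length xs) (Fn f ts))" using Fn.prems by (rule elem_code_code)
  then have "F (code (length xs) (Fn f ts)) xs = F f (map (\<lambda>g. F g xs) (map (code (length xs)) ts))"
    by (simp only: code.simps comp)
  also have "map (\<lambda>g. F g xs) (map (code (length xs)) ts) = map (eval F ((!) xs)) ts"
    using Fn by auto
  finally show ?case by simp
qed

text \<open>
  With \<open>Var 0\<close> as the searched variable and \<open>Var 1, \<dots>, Var n\<close> as parameters, \<open>all_code n p\<close> at \<open>a\<close> is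
  \<open>1\<close> if \<open>p\<close> holds below \<open>a\<close> and \<open>0\<close> otherwise.  Summing it over \<open>1, \<dots>, a\<close> gives in \<open>search_code n p\<close>
  the least counterexample below \<open>a\<close>, or \<open>a\<close> itself if there is none.
\<close>

definition all_code :: "nat \<Rightarrow> fm \<Rightarrow> efun" where
  "all_code n p = CProd (code (Suc n) (chi p))"

definition search_code :: "nat \<Rightarrow> fm \<Rightarrow> efun" where
  "search_code n p =
    CSum (code (Suc n) (Fn (all_code n p) (Succ (Var 0) # map (\<lambda>i. Var (Suc i)) [0..<n])))"

abbreviation bounded :: "nat \<Rightarrow> fm \<Rightarrow> bool" where
  "bounded n p \<equiv> qf p \<and> free_vars p \<subseteq> {..<Suc n}"

lemma elem_all_code: "bounded n p \<Longrightarrow> elem_code (Suc n) (all_code n p)"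
  unfolding all_code_def using wf_chi vars_chi[of p]
  by (auto simp: qf_def intro!: elem_code_code)

lemma elem_search_code: "bounded n p \<Longrightarrow> elem_code (Suc n) (search_code n p)"
  unfolding search_code_def using elem_all_code by (auto intro!: elem_code_code)

context model
begin

definition All :: "nat \<Rightarrow> fm \<Rightarrow> (nat \<Rightarrow> nat) \<Rightarrow> nat \<Rightarrow> nat" where
  "All n p v a = F (all_code n p) (a # map v [0..<n])"

definition Search :: "nat \<Rightarrow> fm \<Rightarrow> (nat \<Rightarrow> nat) \<Rightarrow> nat \<Rightarrow> nat" where
  "Search n p v a = F (search_code n p) (a # map v [0..<n])"

lemma sat_nth:
  assumes "bounded n p"
  shows "sat F ((!) (a # map v [0..<n])) p \<longleftrightarrow> sat F (case_nat a v) p"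
  by (rule sat_cong) (use assms in \<open>auto simp: nth_Cons split: nat.split\<close>)

lemma chi_code:
  assumes "bounded n p"
  shows "F (code (Suc n) (chi p)) (a # map v [0..<n]) = (if sat F (case_nat a v) p then sc zr else zr)"
  using interp_code[of "chi p" "a # map v [0..<n]"] assms wf_chi[of p] vars_chi[of p] sat_nth[OF assms, of a v]
  by (simp add: qf_def eval_chi del: upt_Suc)

lemma elem_chi_code: "bounded n p \<Longrightarrow> elem_code (Suc n) (code (Suc n) (chi p))"
  using wf_chi vars_chi[of p] by (auto simp: qf_def intro!: elem_code_code)

lemma All_zr: "bounded n p \<Longrightarrow> All n p v zr = sc zr"
  using prod_zr[of "map v [0..<n]"] elem_chi_code by (simp add: All_def all_code_def)

lemma All_sc: "bounded n p \<Longrightarrow>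
    All n p v (sc a) = ml (All n p v a) (if sat F (case_nat a v) p then sc zr else zr)"
  using prod_sc[of "map v [0..<n]" "code (Suc n) (chi p)" a] elem_chi_code[of p n] chi_code[of p n a v]
  by (simp add: All_def all_code_def)

lemma
  assumes "bounded n p"
  shows Search_zr: "Search n p v zr = zr"
    and Search_sc: "Search n p v (sc a) = ad (Search n p v a) (All n p v (sc a))"
proof -
  let ?t = "Fn (all_code n p) (Succ (Var 0) # map (\<lambda>i. Var (Suc i)) [0..<n])"
  let ?ys = "map v [0..<n]"
  have *: "wf_tm ?t" "vars_tm ?t \<subseteq> {..<Suc n}" using elem_all_code[OF assms] by auto
  then have elem: "elem_code (Suc (length ?ys)) (code (Suc n) ?t)" using elem_code_code by simp
  have "map ((!) ?ys) [0..<n] = ?ys" using map_nth[of ?ys] by simp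
  then have "F (code (Suc n) ?t) (a # ?ys) = All n p v (sc a)"
    using interp_code[of ?t "a # ?ys"] * by (simp add: All_def comp_def del: map_eq_conv)
  then show "Search n p v zr = zr" "Search n p v (sc a) = ad (Search n p v a) (All n p v (sc a))"
    using sum_zr[OF elem] sum_sc[OF elem, of a] by (simp_all add: Search_def search_code_def)
qed

lemma ml_zr_bit: "ml zr (if b then sc zr else zr) = zr" "ml (sc zr) (if b then sc zr else zr) = (if b then sc zr else zr)"
  by auto

text \<open>By induction on \<open>a\<close>: while \<open>p\<close> holds, \<open>Search\<close>
  counts along with \<open>a\<close>. At the first failure \<open>All\<close> becomes zero and stays
  so, which freezes \<open>Search\<close> at the counterexample.\<close>

lemma search_spec:
  assumes "bounded n p"
  shows "All n p v a = sc zr \<and> Search n p v a = a \<or>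
    All n p v a = zr \<and> \<not> sat F (case_nat (Search n p v a) v) p"
proof -
  let ?xs = "Var 0 # map (\<lambda>i. Var (Suc i)) [0..<n]"
  let ?all = "Fn (all_code n p) ?xs" and ?search = "Fn (search_code n p) ?xs"
  let ?q = "Neg (?all \<^bold>= Succ Zero \<^bold>\<and> ?search \<^bold>= Var 0) \<^bold>\<longrightarrow>
    ?all \<^bold>= Zero \<^bold>\<and> Neg (subst_fm (case_nat ?search (\<lambda>i. Var (Suc i))) p)"
  have q: "sat F (case_nat a v) ?q \<longleftrightarrow> (model.All F n p v a = F CSucc [F CZero []] \<and> model.Search F n p v a = a \<or>
    model.All F n p v a = F CZero [] \<and> \<not> sat F (case_nat (model.Search F n p v a) v) p)" if "model F" for F v a
  proof -
    interpret M: model F by fact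
    show ?thesis
      by (auto simp add: sat_subst eval_case_nat M.All_def M.Search_def comp_def)
  qed
  have "sat F (case_nat a v) ?q"
  proof (rule induction_rule)
    have "wf_tm (case_nat ?search (\<lambda>i. Var (Suc i)) i)" for i
      using elem_search_code[OF assms] by (auto split: nat.split)
    then show "qf ?q"
      using assms elem_all_code[OF assms] elem_search_code[OF assms] by (auto intro: qf_subst)
  next
    fix F :: "efun \<Rightarrow> nat list \<Rightarrow> nat" and a v assume "model F"
    then interpret M: model F .
    show "sat F (case_nat M.zr v) ?q"
      unfolding q[OF \<open>model F\<close>] using M.All_zr[OF assms] M.Search_zr[OF assms] by simp
    show "sat F (case_nat a v) ?q \<Longrightarrow> sat F (case_nat (M.sc a) v) ?q"
      unfolding q[OF \<open>model F\<close>]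
      by (elim disjE conjE) (simp_all add: M.All_sc[OF assms] M.Search_sc[OF assms] M.ml_zr_bit)
  qed (rule model_axioms)
  then show ?thesis unfolding q[OF model_axioms] .
qed

lemma All_cases: "bounded n p \<Longrightarrow> All n p v a = sc zr \<or> All n p v a = zr"
  using search_spec[of p n v a] by blast

lemma All_sc_eq_one:
  assumes "bounded n p"
  shows "All n p v (sc a) = sc zr \<longleftrightarrow> All n p v a = sc zr \<and> sat F (case_nat a v) p"
  using All_cases[OF assms, of v a] by (auto simp: All_sc[OF assms])

end

section \<open>Full induction inside a single model\<close>

context model
begin

text \<open>Here the premises hold in one model only, so \<open>induction_rule\<close> does not
  apply to \<open>p\<close>. It does apply to the quantifier-free \<open>?r\<close>: if the step
  \<open>?q\<close> holds everywhere below \<open>a\<close>, then \<open>p\<close> passes from zero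
  to \<open>a\<close>.\<close>

lemma sat_induction_axiom:
  assumes p: "qf p" and zr: "sat F (case_nat zr v) p"
    and sc: "\<And>a. sat F (case_nat a v) p \<Longrightarrow> sat F (case_nat (sc a) v) p"
  shows "sat F (case_nat a v) p"
proof -
  let ?q = "p \<^bold>\<longrightarrow> subst_fm (case_nat (Succ (Var 0)) (\<lambda>i. Var (Suc i))) p"
  have sat_q: "sat F (case_nat a v) ?q \<longleftrightarrow> (sat F (case_nat a v) p \<longrightarrow> sat F (case_nat (F CSucc [a]) v) p)"
    for F :: "efun \<Rightarrow> nat list \<Rightarrow> nat" and a v
    by (simp add: sat_subst eval_case_nat)
  have "qf ?q" using p by (auto intro: qf_subst split: nat.split)
  moreover obtain n where "\<And>i. i \<in> free_vars ?q \<Longrightarrow> i < n"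
    using finite_nat_set_iff_bounded[of "free_vars ?q"] by (auto simp del: free_vars.simps)
  then have "free_vars ?q \<subseteq> {..<Suc n}" by (auto simp del: free_vars.simps intro: less_SucI)
  ultimately have bounded: "bounded n ?q" ..
  let ?all = "Fn (all_code n ?q) (Var 0 # map (\<lambda>i. Var (Suc i)) [0..<n])"
  let ?r = "?all \<^bold>= Succ Zero \<^bold>\<longrightarrow> subst_fm (case_nat Zero (\<lambda>i. Var (Suc i))) p \<^bold>\<longrightarrow> p"
  have sat_r: "sat F (case_nat a v) ?r \<longleftrightarrow> (model.All F n ?q v a = F CSucc [F CZero []] \<longrightarrow>
    sat F (case_nat (F CZero []) v) p \<longrightarrow> sat F (case_nat a v) p)" if "model F" for F a v
    using that by (simp add: sat_subst eval_case_nat model.All_def comp_def)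
  have "sat F (case_nat a v) ?r"
  proof (rule induction_rule)
    show "qf ?r" using p elem_all_code[OF bounded] by (auto intro!: qf_subst split: nat.split)
  next
    fix F :: "efun \<Rightarrow> nat list \<Rightarrow> nat" and a v assume "model F"
    then interpret M: model F .
    show "sat F (case_nat M.zr v) ?r" unfolding sat_r[OF \<open>model F\<close>] by blast
    show "sat F (case_nat a v) ?r \<Longrightarrow> sat F (case_nat (M.sc a) v) ?r"
      unfolding sat_r[OF \<open>model F\<close>] M.All_sc_eq_one[OF bounded] sat_q by blast
  qed (rule model_axioms)
  \<comment> \<open>The step premise covers in particular the element returned by the search, so
    that element is no counterexample and \<open>All\<close> must be one.\<close>
  moreover have "sat F (case_nat (Search n ?q v a) v) ?q"
    unfolding sat_q using sc by blast
  then have "All n ?q v a = sc zr" using search_spec[OF bounded, of v a] by blast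
  ultimately show ?thesis unfolding sat_r[OF model_axioms] using zr by blast
qed

text \<open>All axioms but induction are quantifier-free. So a model of the quantifier-free
  consequences satisfies all of \<open>EA\<close>, and soundness extends to theorems with
  quantifiers.\<close>

lemma sat_EA: "p \<in> EA \<Longrightarrow> sat F v p"
proof (cases "qf p")
  case True
  then show "p \<in> EA \<Longrightarrow> sat F v p" by (rule sat_EA_qf[rotated])
next
  case False
  assume "p \<in> EA"
  then show ?thesis
  proof cases
    case (induction q)
    have "sat F (case_nat a v) q"
      if "sat F (case_nat zr v) q" "\<And>a. sat F (case_nat a v) q \<Longrightarrow> sat F (case_nat (sc a) v) q" for a
      using sat_induction_axiom[of q v a] that induction by (simp add: qf_def)
    then show ?thesis unfolding induction(1) by (simp add: sat_subst eval_case_nat)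
  qed (use False in \<open>auto simp del: upt_Suc\<close>)
qed

lemma sat_provable: "EA \<turnstile> p \<Longrightarrow> sat F v p"
  unfolding provable_def by (rule soundness[of EA "[]"]) (auto intro: sat_EA)

lemma zr_ad [simp]: "ad zr x = x"
  using sat_induction_axiom[of "Add Zero (Var 0) \<^bold>= Var 0" "\<lambda>_. zr" x] by simp

lemma mo_ad_right: "mo m (ad u m) = zr"
  using sat_induction_axiom[of "Monus (Var 0) (Add (Var 1) (Var 0)) \<^bold>= Zero" "\<lambda>_. u" m]
  by (simp add: mo_sc_sc del: mo_simps)

text \<open>By induction on \<open>m\<close>, the value one descends from \<open>u + m + 1\<close>
  to \<open>u + 1\<close>, where the last factor of the product is the truth value of
  \<open>p\<close> at \<open>u\<close>.\<close>

lemma All_imp: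
  assumes "bounded n p" "All n p v (sc (ad u m)) = sc zr"
  shows "sat F (case_nat u v) p"
proof -
  let ?a = "\<lambda>t. Fn (all_code n p) (Succ t # map (\<lambda>i. Var (Suc (Suc i))) [0..<n]) \<^bold>= Succ Zero"
  let ?q = "?a (Add (Var 1) (Var 0)) \<^bold>\<longrightarrow> ?a (Var 1)"
  have q: "sat F (case_nat m (case_nat u v)) ?q \<longleftrightarrow>
    (All n p v (sc (ad u m)) = sc zr \<longrightarrow> All n p v (sc u) = sc zr)" for m
    by (simp add: All_def comp_def)
  have "sat F (case_nat m (case_nat u v)) ?q"
  proof (rule sat_induction_axiom)
    show "qf ?q" using elem_all_code[OF assms(1)] by auto
    show "sat F (case_nat zr (case_nat u v)) ?q" unfolding q by simp
    show "sat F (case_nat m (case_nat u v)) ?q \<Longrightarrow> sat F (case_nat (sc m) (case_nat u v)) ?q" for m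
      unfolding q using All_sc_eq_one[OF assms(1), of v "sc (ad u m)"] by simp
  qed
  then show ?thesis unfolding q using assms All_sc_eq_one by blast
qed

text \<open>Models may have nonstandard elements. The values of \<open>h\<close> will be standard
  numerals, which can be compared by the order of their indices.\<close>

primrec nm :: "nat \<Rightarrow> nat" where
  "nm 0 = zr"
| "nm (Suc n) = sc (nm n)"

lemma eval_numeral [simp]: "eval F v (numeral_tm n) = nm n"
  by (induction n) auto

lemma mo_nm: "i \<le> j \<Longrightarrow> mo (nm i) (nm j) = zr"
proof (induction i arbitrary: j)
  case (Suc i)
  then show ?case by (cases j) (auto simp: mo_sc_sc simp del: mo_simps)
qed simp

end

section \<open>Herbrand's theorem\<close>

text \<open>Coding the term itself gives injectivity, pairing with the maximal index puts the result
  above all variables of \<open>t\<close>, and \<open>Suc\<close> avoids the parameter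
  \<open>c\<close>, which is \<open>Var 0\<close>.\<close>

definition fresh :: "tm \<Rightarrow> nat" where
  "fresh t = Suc (prod_encode (to_nat t, Max (insert 0 (vars_tm t))))"

lemma inj_fresh: "inj fresh"
  by (auto simp: inj_def fresh_def)

lemma vars_less_fresh: "i \<in> vars_tm t \<Longrightarrow> i < fresh t"
  unfolding fresh_def less_Suc_eq_le
  by (rule order_trans[OF Max_ge le_prod_encode_2]) auto

abbreviation holds :: "(efun \<Rightarrow> 'a list \<Rightarrow> 'a) \<Rightarrow> fm \<Rightarrow> 'a \<Rightarrow> 'a \<Rightarrow> 'a \<Rightarrow> bool" where
  "holds F B u z c \<equiv> sat F (case_nat u (case_nat z (\<lambda>_. c))) B"

theorem Herbrand:
  assumes "qf B" "EA \<turnstile> Exists (Forall B)" "free_vars B \<subseteq> {0, 1, 2}"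
  obtains ts where "\<forall>t \<in> set ts. wf_tm t" "sorted_wrt (\<lambda>s t. fresh s < fresh t) ts"
    "\<And>F v. model F \<Longrightarrow> \<exists>t \<in> set ts. holds F B (v (fresh t)) (eval F v t) (v 0)"
proof -
  define \<beta> where "\<beta> t = Neg (subst_fm (case_nat (Var (fresh t)) (case_nat t (\<lambda>_. Var 0))) B)" for t
  have sat_\<beta>: "sat F v (\<beta> t) \<longleftrightarrow> \<not> holds F B (v (fresh t)) (eval F v t) (v 0)"
    for F :: "efun \<Rightarrow> nat list \<Rightarrow> nat" and v t
    by (simp add: \<beta>_def sat_subst eval_case_nat)
  have "\<not> consistent EA (\<beta> ` {t. wf_tm t})"
  proof
    assume "consistent EA (\<beta> ` {t. wf_tm t})"
    moreover have "\<forall>p \<in> \<beta> ` {t. wf_tm t}. qf p"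
      using assms(1) by (auto simp: \<beta>_def intro!: qf_subst split: nat.split)
    ultimately obtain F v where F: "ea_model F" and v: "\<forall>p \<in> \<beta> ` {t. wf_tm t}. sat F v p"
      and gen: "\<And>a. \<exists>t. wf_tm t \<and> eval F v t = a"
      using consistent_has_term_model by metis
    interpret model F by (rule model.intro[OF F])
    have "sat F (\<lambda>_. v 0) (Exists (Forall B))" by (rule sat_provable[OF assms(2)])
    then obtain z where z: "\<And>u. holds F B u z (v 0)" by auto
    \<comment> \<open>The model is generated by terms, so refuting every term refutes every element,
      including \<open>z\<close>.\<close>
    obtain t where "wf_tm t" "eval F v t = z" using gen by blast
    then show False using v z sat_\<beta>[of F v t] by auto
  qed
  then obtain \<Gamma> where \<Gamma>: "set \<Gamma> \<subseteq> \<beta> ` {t. wf_tm t}" "deriv EA \<Gamma> Bot"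
    unfolding consistent_def by blast
  then obtain A where A: "A \<subseteq> {t. wf_tm t}" "finite A" "set \<Gamma> = \<beta> ` A"
    using finite_subset_image[of "set \<Gamma>" \<beta> "{t. wf_tm t}"] by auto
  \<comment> \<open>In this order a term contains no witness variable of its own or of a later
    term.\<close>
  define ts where "ts = map (inv fresh) (sorted_list_of_set (fresh ` A))"
  have set_ts: "set ts = A"
    using A(2) by (simp add: ts_def image_image inj_fresh)
  have "sorted_wrt (\<lambda>i j. fresh (inv fresh i) < fresh (inv fresh j)) (sorted_list_of_set (fresh ` A))"
    by (rule sorted_wrt_mono_rel[OF _ strict_sorted_list_of_set])
      (use A(2) in \<open>auto simp: inj_fresh\<close>)
  then have sorted: "sorted_wrt (\<lambda>s t. fresh s < fresh t) ts"
    by (simp add: ts_def sorted_wrt_map)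
  have "\<exists>t \<in> set ts. holds F B (v (fresh t)) (eval F v t) (v 0)" if "model F" for F v
  proof (rule ccontr)
    assume "\<not> ?thesis"
    then have "\<forall>q \<in> set \<Gamma>. sat F v q" using sat_\<beta> A set_ts by auto
    then have "sat F v Bot"
      using soundness[OF \<Gamma>(2)] model.sat_EA[OF that] by blast
    then show False by simp
  qed
  with A set_ts sorted show ?thesis by (intro that) auto
qed

section \<open>The descending approximation\<close>

text \<open>Arithmetized case distinction; the selector \<open>g\<close> is meant to take only the
  values one and zero.\<close>

definition Cond :: "tm \<Rightarrow> tm \<Rightarrow> tm \<Rightarrow> tm" where
  "Cond g s t = Add (Mul s g) (Mul t (Monus (Succ Zero) g))"

lemma (in model) eval_Cond:
  "eval F v g = sc zr \<Longrightarrow> eval F v (Cond g s t) = eval F v s"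
  "eval F v g = zr \<Longrightarrow> eval F v (Cond g s t) = eval F v t"
  by (simp_all add: Cond_def)

definition env :: "'a \<Rightarrow> 'a \<Rightarrow> nat \<Rightarrow> 'a" where
  "env c w = case_nat c (\<lambda>_. w)"

text \<open>
  The Herbrand disjunction for the remaining terms \<open>ts\<close>, the earlier witness variables being fixed by
  \<open>\<rho>\<close>.  Correspondingly, in \<open>solves\<close> the terms \<open>f\<close> and \<open>h\<close> are in the variables \<open>c, w\<close> (\<open>Var 0\<close> and
  \<open>Var 1\<close>), and \<open>\<sigma>\<close> maps each earlier witness variable to the term computing its witness from \<open>c, w\<close>.
  The limit value is only evaluated at stages \<open>w = u + m + 1\<close>, which exceed \<open>u\<close> and \<open>m\<close>.
\<close>

definition Disj :: "(efun \<Rightarrow> 'a list \<Rightarrow> 'a) \<Rightarrow> fm \<Rightarrow> tm list \<Rightarrow> (nat \<Rightarrow> 'a) \<Rightarrow> bool" where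
  "Disj F B ts \<rho> \<longleftrightarrow> (\<forall>v. (\<forall>i. i \<notin> fresh ` set ts \<longrightarrow> v i = \<rho> i) \<longrightarrow>
    (\<exists>t \<in> set ts. holds F B (v (fresh t)) (eval F v t) (v 0)))"

definition solves :: "fm \<Rightarrow> tm list \<Rightarrow> (nat \<Rightarrow> tm) \<Rightarrow> tm \<Rightarrow> tm \<Rightarrow> bool" where
  "solves B ts \<sigma> f h \<longleftrightarrow> wf_tm f \<and> wf_tm h \<and> vars_tm f \<subseteq> {0, 1} \<and> vars_tm h \<subseteq> {0, 1} \<and>
    (\<forall>F c w. model F \<longrightarrow>
      (\<exists>j \<le> length ts. eval F (env c w) h = model.nm F j) \<and>
      (Disj F B ts (\<lambda>i. eval F (env c w) (\<sigma> i)) \<longrightarrow>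
        (\<forall>u m. w = F CSucc [F CAdd [u, m]] \<longrightarrow> holds F B u (eval F (env c w) f) c) \<and>
        ((\<forall>i. eval F (env c (F CSucc [w])) (\<sigma> i) = eval F (env c w) (\<sigma> i)) \<longrightarrow>
          eval F (env c (F CSucc [w])) f = eval F (env c w) f \<and>
          eval F (env c (F CSucc [w])) h = eval F (env c w) h \<or>
          (\<exists>i j. i < j \<and> eval F (env c (F CSucc [w])) h = model.nm F i \<and>
            eval F (env c w) h = model.nm F j))))"

lemma vars_subst_tm: "vars_tm (subst_tm \<sigma> t) = (\<Union>i \<in> vars_tm t. vars_tm (\<sigma> i))"
  by (induction t) auto

text \<open>If the first term survives the search below \<open>w\<close>, it is the answer and
  \<open>h\<close> is the number of terms left. Otherwise its witness variable is bound to the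
  counterexample found, and the recursion answers with the later terms and a smaller
  \<open>h\<close>.\<close>

lemma solves_exists:
  assumes "qf B" "free_vars B \<subseteq> {0, 1, 2}"
    and "\<forall>t \<in> set ts. wf_tm t" "sorted_wrt (\<lambda>s t. fresh s < fresh t) ts"
    and "\<sigma> 0 = Var 0" "\<And>i. wf_tm (\<sigma> i)" "\<And>i. vars_tm (\<sigma> i) \<subseteq> {0, 1}"
  shows "\<exists>f h. solves B ts \<sigma> f h"
  using assms(3-)
proof (induction ts arbitrary: \<sigma>)
  case Nil
  have "\<not> Disj F B [] \<rho>" for F :: "efun \<Rightarrow> nat list \<Rightarrow> nat" and \<rho>
    by (auto simp: Disj_def)
  moreover have "eval F v Zero = model.nm F 0" if "model F" for F v
    using that by (simp add: model.nm.simps)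
  ultimately have "solves B [] \<sigma> Zero Zero" by (simp add: solves_def)
  then show ?case by blast
next
  case (Cons s ts)
  define T where "T = subst_tm \<sigma> s"
  \<comment> \<open>The arguments are the search bound \<open>w\<close> and the parameters
    \<open>z\<close> and \<open>c\<close> of \<open>B\<close>, with \<open>T\<close> for
    \<open>z\<close>.\<close>
  define U where "U = Fn (search_code 2 B) [Var 1, T, Var 0]"
  define g where "g = Fn (all_code 2 B) [Var 1, T, Var 0]"
  define \<sigma>' where "\<sigma>' = \<sigma>(fresh s := U)"
  have bounded: "bounded 2 B" using assms(1,2) by auto
  have "vars_tm T \<subseteq> {0, 1}" unfolding T_def vars_subst_tm using Cons.prems(5) by blast
  moreover have "wf_tm T" using Cons.prems(1,4) by (simp add: T_def wf_subst_tm)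
  ultimately have T: "wf_tm T" "vars_tm T \<subseteq> {0, 1}" by auto
  have U: "wf_tm U" "vars_tm U \<subseteq> {0, 1}" and g: "wf_tm g" "vars_tm g \<subseteq> {0, 1}"
    using T elem_all_code[OF bounded] elem_search_code[OF bounded] by (auto simp: U_def g_def numeral_eq_Suc)
  have "0 < fresh s" by (simp add: fresh_def)
  have "\<exists>f h. solves B ts \<sigma>' f h"
    by (rule Cons.IH) (use Cons.prems U \<open>0 < fresh s\<close> in \<open>auto simp: \<sigma>'_def\<close>)
  then obtain f h where fh: "solves B ts \<sigma>' f h" by blast
  have "solves B (s # ts) \<sigma> (Cond g T f) (Cond g (numeral_tm (Suc (length ts))) h)"
    unfolding solves_def
  proof (intro conjI allI impI)
    have wf: "wf_tm f" "wf_tm h" "vars_tm f \<subseteq> {0, 1}" "vars_tm h \<subseteq> {0, 1}"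
      using fh by (auto simp: solves_def)
    have "vars_tm (numeral_tm n) = {}" for n by (induction n) auto
    then show "wf_tm (Cond g T f)" "vars_tm (Cond g T f) \<subseteq> {0, 1}"
      "wf_tm (Cond g (numeral_tm (Suc (length ts))) h)"
      "vars_tm (Cond g (numeral_tm (Suc (length ts))) h) \<subseteq> {0, 1}"
      using wf T g by (simp_all add: Cond_def)
    fix F :: "efun \<Rightarrow> nat list \<Rightarrow> nat" and c w assume "model F"
    then interpret M: model F .
    let ?h = "Cond g (numeral_tm (Suc (length ts))) h"
    let ?T = "\<lambda>w. eval F (env c w) T"
    let ?params = "\<lambda>w. case_nat (?T w) (\<lambda>_. c)"
    have eval_U: "eval F (env c w) U = M.Search 2 B (?params w) w"
      and eval_g: "eval F (env c w) g = M.All 2 B (?params w) w" for w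
      by (simp_all add: U_def g_def M.Search_def M.All_def env_def numeral_2_eq_2)
    have h: "\<exists>j \<le> length ts. eval F (env c w) h = M.nm j" for w
      using fh \<open>model F\<close> unfolding solves_def by blast
    note Cond1 = M.eval_Cond(1)[of "env c w" g for w] and Cond0 = M.eval_Cond(2)[of "env c w" g for w]
    show "\<exists>j \<le> length (s # ts). eval F (env c w) ?h = M.nm j"
    proof (cases "eval F (env c w) g = M.zr")
      case True
      obtain j where "j \<le> length ts" "eval F (env c w) h = M.nm j" using h by blast
      then show ?thesis using Cond0[OF True] by (intro exI[of _ j]) auto
    next
      case False
      then have "eval F (env c w) g = M.sc M.zr" using M.All_cases[OF bounded] unfolding eval_g by blast
      then show ?thesis using Cond1 by (intro exI[of _ "Suc (length ts)"]) (simp del: numeral_tm.simps)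
    qed
    assume Disj: "Disj F B (s # ts) (\<lambda>i. eval F (env c w) (\<sigma> i))"
    \<comment> \<open>The search result refutes \<open>s\<close>, so its disjunct is false and the
      disjunction survives for \<open>ts\<close>.\<close>
    have Disj': "Disj F B ts (\<lambda>i. eval F (env c w) (\<sigma>' i))" if "eval F (env c w) g = M.zr"
      unfolding Disj_def
    proof (intro allI impI)
      fix v assume v: "\<forall>i. i \<notin> fresh ` set ts \<longrightarrow> v i = eval F (env c w) (\<sigma>' i)"
      have less: "fresh s < fresh t" if "t \<in> set ts" for t using Cons.prems(2) that by simp
      have "\<forall>i. i \<notin> fresh ` set (s # ts) \<longrightarrow> v i = eval F (env c w) (\<sigma> i)"
        using v by (simp add: \<sigma>'_def)
      then obtain t where t: "t \<in> set (s # ts)" "holds F B (v (fresh t)) (eval F v t) (v 0)"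
        using Disj unfolding Disj_def by blast
      have "t \<noteq> s"
      proof
        assume "t = s"
        have "fresh s \<notin> fresh ` set ts" using less by force
        then have "v (fresh s) = M.Search 2 B (?params w) w" using v eval_U by (simp add: \<sigma>'_def)
        moreover have "v 0 = c"
        proof -
          have "0 \<notin> fresh ` set ts" by (auto simp: fresh_def)
          then show ?thesis using v Cons.prems(3) by (simp add: \<sigma>'_def fresh_def env_def)
        qed
        \<comment> \<open>The variables of \<open>s\<close> lie below \<open>fresh s\<close>, so the
          freely chosen later witnesses do not affect its value.\<close>
        moreover have "eval F v s = ?T w"
          unfolding T_def eval_subst
        proof (rule eval_cong)
          fix i assume "i \<in> vars_tm s"
          then have "i < fresh s" by (rule vars_less_fresh)
          then have "i \<notin> fresh ` set ts" "i \<noteq> fresh s" using less by force+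
          then show "v i = eval F (env c w) (\<sigma> i)" using v by (simp add: \<sigma>'_def)
        qed
        ultimately have "holds F B (M.Search 2 B (?params w) w) (?T w) c" using t \<open>t = s\<close> by simp
        then show False using that M.search_spec[OF bounded, of "?params w" w] by (simp add: eval_g)
      qed
      then show "\<exists>t \<in> set ts. holds F B (v (fresh t)) (eval F v t) (v 0)" using t by auto
    qed
    have fh_w: "\<forall>u m. w = M.sc (M.ad u m) \<longrightarrow> holds F B u (eval F (env c w) f) c"
      "(\<forall>i. eval F (env c (M.sc w)) (\<sigma>' i) = eval F (env c w) (\<sigma>' i)) \<Longrightarrow>
          eval F (env c (M.sc w)) f = eval F (env c w) f \<and>
          eval F (env c (M.sc w)) h = eval F (env c w) h \<or>
          (\<exists>i j. i < j \<and> eval F (env c (M.sc w)) h = M.nm i \<and> eval F (env c w) h = M.nm j)"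
      if "eval F (env c w) g = M.zr"
      using fh Disj'[OF that] \<open>model F\<close> unfolding solves_def by blast+
    {
      fix u m assume w: "w = M.sc (M.ad u m)"
      show "holds F B u (eval F (env c w) (Cond g T f)) c"
      proof (cases "eval F (env c w) g = M.zr")
        case True
        then show ?thesis using fh_w(1)[OF True] w Cond0[OF True] by simp
      next
        case False
        then have g1: "eval F (env c w) g = M.sc M.zr" using M.All_cases[OF bounded] unfolding eval_g by blast
        \<comment> \<open>The search below \<open>w = u + m + 1\<close> has passed over
          \<open>u\<close>.\<close>
        then have "holds F B u (?T w) c"
          using M.All_imp[OF bounded, of "?params w" u m] unfolding eval_g w by blast
        then show ?thesis using Cond1[OF g1] by simp
      qed
    next
      assume same: "\<forall>i. eval F (env c (M.sc w)) (\<sigma> i) = eval F (env c w) (\<sigma> i)"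
      have T_same: "?T (M.sc w) = ?T w" unfolding T_def eval_subst using same by simp
      show "eval F (env c (M.sc w)) (Cond g T f) = eval F (env c w) (Cond g T f) \<and>
          eval F (env c (M.sc w)) ?h = eval F (env c w) ?h \<or>
          (\<exists>i j. i < j \<and> eval F (env c (M.sc w)) ?h = M.nm i \<and> eval F (env c w) ?h = M.nm j)"
      proof (cases "eval F (env c w) g = M.zr")
        case True
        then have "M.All 2 B (?params w) w = M.zr" by (simp add: eval_g)
        then have All: "M.All 2 B (?params w) (M.sc w) = M.zr"
          using M.All_sc_eq_one[OF bounded, of "?params w" w] M.All_cases[OF bounded, of "?params w" "M.sc w"] by auto
        then have g0: "eval F (env c (M.sc w)) g = M.zr" by (simp add: eval_g T_same)
        \<comment> \<open>The next summand of the search is zero, so the witness stays the same and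
          the recursive solution can be compared at \<open>w\<close> and
          \<open>w + 1\<close>.\<close>
        have "eval F (env c (M.sc w)) U = eval F (env c w) U"
          unfolding eval_U T_same M.Search_sc[OF bounded] All by simp
        then have "\<forall>i. eval F (env c (M.sc w)) (\<sigma>' i) = eval F (env c w) (\<sigma>' i)"
          using same by (simp add: \<sigma>'_def)
        from fh_w(2)[OF True this] show ?thesis by (simp add: Cond0[OF True] Cond0[OF g0])
      next
        case False
        then have g1: "eval F (env c w) g = M.sc M.zr" using M.All_cases[OF bounded] unfolding eval_g by blast
        show ?thesis
        proof (cases "eval F (env c (M.sc w)) g = M.zr")
          case True
          \<comment> \<open>\<open>T\<close> has just been refuted: \<open>h\<close> drops from
            \<open>Suc (length ts)\<close> to at most \<open>length ts\<close>, whatever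
            \<open>f\<close> becomes.\<close>
          obtain j where "j \<le> length ts" "eval F (env c (M.sc w)) h = M.nm j" using h by blast
          then show ?thesis
            unfolding Cond1[OF g1] Cond0[OF True] M.eval_numeral
            by (intro disjI2 exI[of _ j] exI[of _ "Suc (length ts)"]) simp
        next
          case False
          then have "eval F (env c (M.sc w)) g = M.sc M.zr" using M.All_cases[OF bounded] unfolding eval_g by blast
          then show ?thesis by (simp add: Cond1 g1 T_same del: numeral_tm.simps)
        qed
      qed
    }
  qed
  then show ?case by blast
qed

section \<open>From terms to function codes and the limit statement\<close>

lemma (in model) eval_code:
  assumes "wf_tm t" "vars_tm t \<subseteq> {0, 1}"
  shows "F (code 2 t) [c, w] = eval F (env c w) t"
proof -
  have "F (code 2 t) [c, w] = eval F ((!) [c, w]) t"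
    using interp_code[of t "[c, w]"] assms by (auto simp: numeral_2_eq_2)
  also have "\<dots> = eval F (env c w) t"
    by (rule eval_cong) (use assms(2) in \<open>auto simp: env_def\<close>)
  finally show ?thesis .
qed

text \<open>The limit has quantifiers, so the derivation is explicit and only its quantifier-free
  pieces come from completeness. Given \<open>u\<close> and a modulus \<open>m\<close>, the stage
  \<open>u + m + 1\<close> is at least \<open>m\<close> and so carries the limit value.\<close>

lemma provable_Lim_imp:
  assumes "elem_code 2 f" "qf B" "free_vars B \<subseteq> {0, 1, 2}"
    and "\<And>F u m z c. model F \<Longrightarrow> F f [c, F CSucc [F CAdd [u, m]]] = z \<Longrightarrow> holds F B u z c"
  shows "EA \<turnstile> (Lim_eq f (Var 1) (Var 0) \<^bold>\<longrightarrow> Forall B)"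
proof -
  let ?t = "Succ (Add (Var 1) (Var 0))"
  \<comment> \<open>The number \<open>k\<close> counts the quantifiers opened outside the limit
    formula.\<close>
  let ?body = "\<lambda>k. Var 1 \<^bold>\<le> Var 0 \<^bold>\<longrightarrow> Fn f [Var (Suc (Suc (Suc k))), Var 0] \<^bold>= Var (Suc (Suc k))"
  let ?lim = "\<lambda>k. Exists (Forall (?body k))"
  have wf: "wf_fm (?lim k)" "wf_fm B" for k using assms(1,2) by (auto simp: qf_def numeral_2_eq_2)
  have le: "EA \<turnstile> Var 0 \<^bold>\<le> ?t"
  proof (rule qf_completeness)
    show "sat F v (Var 0 \<^bold>\<le> ?t)" if "ea_model F" for F v
    proof -
      interpret model F by (rule model.intro[OF that])
      show ?thesis by (simp add: mo_ad_right)
    qed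
  qed simp
  have B: "EA \<turnstile> (Fn f [Var 3, ?t] \<^bold>= Var 2 \<^bold>\<longrightarrow> lift_fm B)"
  proof (rule qf_completeness)
    show "qf (Fn f [Var 3, ?t] \<^bold>= Var 2 \<^bold>\<longrightarrow> lift_fm B)"
      using assms(1,2) by (auto simp: numeral_2_eq_2 intro: qf_subst)
    show "sat F v (Fn f [Var 3, ?t] \<^bold>= Var 2 \<^bold>\<longrightarrow> lift_fm B)" if "ea_model F" for F v
    proof -
      have "sat F (\<lambda>i. v (Suc i)) B \<longleftrightarrow> holds F B (v 1) (v 2) (v 3)"
        by (rule sat_cong) (use assms(3) in \<open>auto simp: numeral_eq_Suc\<close>)
      then show ?thesis using assms(4)[OF model.intro[OF that], of "v 3" "v 1" "v 0"]
        by (auto simp: sat_subst)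
    qed
  qed
  \<comment> \<open>In this context \<open>Var 0\<close>, \<open>Var 1\<close>, \<open>Var 2\<close>
    and \<open>Var 3\<close> are \<open>m\<close>, \<open>u\<close>, \<open>z\<close> and
    \<open>c\<close>.\<close>
  let ?\<Gamma> = "[Forall (?body 1), lift_fm (Neg B), ?lim 2]"
  have "deriv EA ?\<Gamma> (Forall (?body 1))"
    by (rule assm) (use wf(1)[of 1] in auto)
  then have "deriv EA ?\<Gamma> (inst (?body 1) ?t)"
    by (rule all_E) simp
  then have "deriv EA ?\<Gamma> (Var 0 \<^bold>\<le> ?t \<^bold>\<longrightarrow> Fn f [Var 3, ?t] \<^bold>= Var 2)"
    by (simp add: numeral_eq_Suc)
  moreover have "deriv EA ?\<Gamma> (Var 0 \<^bold>\<le> ?t)"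
    by (rule deriv_weaken[OF le[unfolded provable_def]]) simp
  ultimately have "deriv EA ?\<Gamma> (Fn f [Var 3, ?t] \<^bold>= Var 2)" by (rule imp_E)
  moreover have "deriv EA ?\<Gamma> (Fn f [Var 3, ?t] \<^bold>= Var 2 \<^bold>\<longrightarrow> lift_fm B)"
    by (rule deriv_weaken[OF B[unfolded provable_def]]) simp
  ultimately have "deriv EA ?\<Gamma> (lift_fm B)" by (rule imp_E[rotated])
  moreover have "deriv EA ?\<Gamma> (Neg (lift_fm B))"
    by (rule assm) (use wf in \<open>auto intro: wf_subst_fm\<close>)
  ultimately have "deriv EA ?\<Gamma> Bot" by (rule imp_E[rotated])
  then have "deriv EA [lift_fm (Neg B), ?lim 2] (Neg (Forall (?body 1)))"
    by (rule imp_I[rotated]) (use wf(1)[of 1] in auto)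
  \<comment> \<open>Existential elimination in classical form: under \<open>Neg B\<close> every
    candidate modulus is refuted.\<close>
  then have "deriv EA [Neg B, ?lim 1] (Forall (Neg (Forall (?body 1))))"
    by (intro all_I) (simp add: numeral_eq_Suc)
  moreover have "deriv EA [Neg B, ?lim 1] (?lim 1)"
    by (rule assm) (use wf(1)[of 1] in auto)
  ultimately have "deriv EA [Neg B, ?lim 1] Bot" by (rule imp_E[rotated])
  then have "deriv EA [?lim 1] B" by (rule contra[OF wf(2)])
  then have "deriv EA [?lim 0] (Forall B)"
    by (intro all_I) (simp add: numeral_eq_Suc)
  then have "deriv EA [] (?lim 0 \<^bold>\<longrightarrow> Forall B)" by (rule imp_I[OF wf(1)])
  then show ?thesis by (simp add: provable_def Lim_eq_def)
qed

theorem theorem3p4: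
  fixes B :: fm
  assumes "wf_fm B" and "quantifier_free B" and "free_vars B \<subseteq> {0, 1, 2}"
    and "EA \<turnstile> Exists (Forall B)"
  shows "\<exists>f h K. elem_code 2 f \<and> elem_code 2 h \<and>
    EA \<turnstile> (Fn h [Var 0, Var 1] \<^bold>< numeral_tm K \<^bold>\<and>
          Fn h [Var 0, Succ (Var 1)] \<^bold>\<le> Fn h [Var 0, Var 1]) \<and>
    EA \<turnstile> (Neg (Fn f [Var 0, Var 1] \<^bold>= Fn f [Var 0, Succ (Var 1)]) \<^bold>\<longrightarrow>
          Fn h [Var 0, Succ (Var 1)] \<^bold>< Fn h [Var 0, Var 1]) \<and>
    EA \<turnstile> (Lim_eq f (Var 1) (Var 0) \<^bold>\<longrightarrow> Forall B)"
proof -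
  have B: "qf B" using assms by (simp add: qf_def)
  obtain ts where ts: "\<forall>t \<in> set ts. wf_tm t" "sorted_wrt (\<lambda>s t. fresh s < fresh t) ts"
    and disj: "\<And>F v. model F \<Longrightarrow> \<exists>t \<in> set ts. holds F B (v (fresh t)) (eval F v t) (v 0)"
    using Herbrand[OF B assms(4,3)] by metis
  \<comment> \<open>No witness has been found yet. Only \<open>c\<close> keeps its value and all
    other variables become zero, so nothing depends on \<open>w\<close>; the Herbrand disjunction
    holds under every valuation.\<close>
  define \<sigma> where "\<sigma> = case_nat (Var 0) (\<lambda>_. Zero)"
  have "\<exists>f h. solves B ts \<sigma> f h"
    by (rule solves_exists[OF B assms(3) ts]) (auto simp: \<sigma>_def split: nat.splits)
  then obtain f h where fh: "solves B ts \<sigma> f h" by blast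
  let ?f = "code 2 f" and ?h = "code 2 h"
  have wf: "wf_tm f" "wf_tm h" "vars_tm f \<subseteq> {0, 1}" "vars_tm h \<subseteq> {0, 1}"
    using fh by (auto simp: solves_def)
  then have elem: "elem_code 2 ?f" "elem_code 2 ?h" by (auto intro!: elem_code_code)
  have sem: "\<exists>j \<le> length ts. F ?h [c, w] = model.nm F j"
      "w = F CSucc [F CAdd [u, m]] \<Longrightarrow> holds F B u (F ?f [c, w]) c"
      "F ?f [c, F CSucc [w]] = F ?f [c, w] \<and> F ?h [c, F CSucc [w]] = F ?h [c, w] \<or>
        (\<exists>i j. i < j \<and> F ?h [c, F CSucc [w]] = model.nm F i \<and> F ?h [c, w] = model.nm F j)"
    if "model F" for F c w u m
  proof -
    interpret model F by fact
    have "Disj F B ts (\<lambda>i. eval F (env c w) (\<sigma> i))" for c w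
      using disj[OF that] unfolding Disj_def by blast
    moreover have "eval F (env c (sc w)) (\<sigma> i) = eval F (env c w) (\<sigma> i)" for c w i
      by (auto simp: \<sigma>_def env_def split: nat.split)
    ultimately show "\<exists>j \<le> length ts. F ?h [c, w] = model.nm F j"
      "w = F CSucc [F CAdd [u, m]] \<Longrightarrow> holds F B u (F ?f [c, w]) c"
      "F ?f [c, F CSucc [w]] = F ?f [c, w] \<and> F ?h [c, F CSucc [w]] = F ?h [c, w] \<or>
        (\<exists>i j. i < j \<and> F ?h [c, F CSucc [w]] = model.nm F i \<and> F ?h [c, w] = model.nm F j)"
      using fh that unfolding solves_def by (auto simp: eval_code wf)
  qed
  \<comment> \<open>The values of \<open>h\<close> are numerals up to the number of terms, hence
    this \<open>K\<close>.\<close>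
  have "EA \<turnstile> (Fn ?h [Var 0, Var 1] \<^bold>< numeral_tm (Suc (length ts)) \<^bold>\<and>
      Fn ?h [Var 0, Succ (Var 1)] \<^bold>\<le> Fn ?h [Var 0, Var 1])" (is "EA \<turnstile> ?p")
  proof (rule qf_completeness)
    show "qf ?p" using elem by (simp add: numeral_2_eq_2)
    fix F and v :: "nat \<Rightarrow> nat" assume "ea_model F"
    then interpret model F by (rule model.intro)
    have "mo (F ?h [v 0, v 1]) (nm (length ts)) = zr"
      using sem(1)[OF model_axioms] mo_nm by metis
    moreover have "mo (F ?h [v 0, sc (v 1)]) (F ?h [v 0, v 1]) = zr"
      using sem(3)[OF model_axioms, of "v 0" "v 1"] mo_nm by (auto simp del: mo_simps)
    ultimately show "sat F v ?p" by (simp add: mo_sc_sc del: mo_simps)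
  qed
  moreover have "EA \<turnstile> (Neg (Fn ?f [Var 0, Var 1] \<^bold>= Fn ?f [Var 0, Succ (Var 1)]) \<^bold>\<longrightarrow>
      Fn ?h [Var 0, Succ (Var 1)] \<^bold>< Fn ?h [Var 0, Var 1])" (is "EA \<turnstile> ?p")
  proof (rule qf_completeness)
    show "qf ?p" using elem by (simp add: numeral_2_eq_2)
    fix F and v :: "nat \<Rightarrow> nat" assume "ea_model F"
    then interpret model F by (rule model.intro)
    have "mo (sc (nm i)) (nm j) = zr" if "i < j" for i j
      using mo_nm[of "Suc i" j] that by simp
    then show "sat F v ?p"
      using sem(3)[OF model_axioms, of "v 0" "v 1"] by (auto simp del: mo_simps)
  qed
  moreover have "EA \<turnstile> (Lim_eq ?f (Var 1) (Var 0) \<^bold>\<longrightarrow> Forall B)"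
    by (rule provable_Lim_imp[OF elem(1) B assms(3)]) (use sem(2) in blast)
  ultimately show ?thesis using elem by blast
qed

end
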